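(* Let $\mathbb{K}$ be an imaginary quadratic field and let $\beta_{1}$ be an algebraic integer with $[\mathbb{K}(\beta_{1}):\mathbb{K}]\leq 2$. If $\mathbb{K}(\beta_{1})=\mathbb{K}$, let $\tau=1$; otherwise let $\tau$ be an algebraic integer in $\mathbb{K}$ such that $\mathbb{K}(\beta_{1})=\mathbb{K}(\sqrt{\tau})$. If $\beta_{1}\in\mathbb{K}$, let $\beta_{2},\gamma_{1},\gamma_{2}\in\mathbb{K}$ with $\gamma_1,\gamma_2$ non-zero, $\beta_{2}\neq\beta_{1}$ and $\beta_{2}$ an algebraic integer. If $[\mathbb{K}(\beta_{1}):\mathbb{K}]=2$, let $\beta_{2}$ be the algebraic conjugate of $\beta_{1}$ over $\mathbb{K}$, let $\gamma_{1}\in\mathbb{K}(\beta_{1})$ and let $\gamma_{2}$ be the algebraic conjugate of $\gamma_{1}$ over $\mathbb{K}$ (so $\gamma_1=\gamma_2$ if they are elements of $\mathbb{K}$). For an algebraic integer $x\in\mathbb{K}$ and a rational integer $n\geq 3$, put $$U(x)=-\gamma_{2}(x-\beta_{2})^{n},\quad Z(x)=\gamma_{1}(x-\beta_{1})^{n},\quad W(x)=\frac{Z(x)}{U(x)},$$ $$\mathcal{A}(x)=\frac{\beta_{1}(x-\beta_{2})W(x)^{1/n}-\beta_{2}(x-\beta_{1})}{(x-\beta_{2})W(x)^{1/n}-(x-\beta_{1})}.$$ Let $g$ be an algebraic number such that $U(x)/g$ and $Z(x)/g$ are algebraic integers (not necessarily in $\mathbb{K}(\beta_{1})$). For each non-negative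 integer $r$, let $h_{r}$ be a non-zero algebraic integer with $h_{r}/g^{r}\in\mathbb{K}$ and $|h_{r}|\leq h$ for some fixed positive real number $h$. Let $d$ be the largest positive rational integer such that $(U(x)-Z(x))/(dg)$ is an algebraic integer, and let $\mathcal{C}_{n}$ and $\mathcal{D}_{n}$ be positive real numbers such that $$\max\left(1,\frac{\Gamma(1-1/n)\,r!}{\Gamma(r+1-1/n)},\frac{n\Gamma(r+1+1/n)}{\Gamma(1/n)\,r!}\right)\frac{D_{n,r}}{N_{d,n,r}}<\mathcal{C}_{n}\left(\frac{\mathcal{D}_{n}}{\mathcal{N}_{d,n}}\right)^{r}$$ holds for all non-negative integers $r$. Put $$E=\frac{|g|\mathcal{N}_{d,n}}{\mathcal{D}_{n}}\cdot\frac{4\left(|U(x)|-|Z(x)-U(x)|\right)}{|Z(x)-U(x)|^{2}},\qquad Q=\frac{\mathcal{D}_{n}}{|g|\mathcal{N}_{d,n}}\,2\left(|U(x)|+|Z(x)|\right),\qquad \kappa=\frac{\log Q}{\log E},$$ $$c=4h|\sqrt{\tau}|\left(|x-\beta_{1}|+|x-\beta_{2}|\right)\mathcal{C}_{n}Q\,\max\left(1,\,2h|\sqrt{\tau}|\left|1-W(x)^{1/n}\right||x-\beta_{2}|\left|\mathcal{A}(x)-\beta_{1}\right|\mathcal{C}_{n}E\right)^{\kappa}.$$ If $E>1$ and $\max\left(|1-W(x)|,|1-1/W(x)|\right)<1$, then $$\left|\mathcal{A}(x)-\frac{p}{q}\right|>\frac{1}{c|q|^{\kappa+1}}$$ for all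 algebraic integers $p$ and $q$ in $\mathbb{K}$ with $q\neq0$.
   Context: All fields are subfields of $\mathbb{C}$. For a complex number $w=se^{i\varphi}$ with $s\geq0$, $-\pi<\varphi\leq\pi$ (and $\varphi=0$ if $s=0$), $w^{1/n}$ denotes $s^{1/n}e^{i\varphi/n}$, where $s^{1/n}$ is the non-negative real $n$-th root; $\sqrt{w}=w^{1/2}$. For a positive integer $n\ge 2$ and a non-negative integer $r$, $X_{n,r}(x)={}_2F_1(-r,-r-1/n;1-1/n;x)$, a polynomial of degree $r$ with rational coefficients (${}_2F_1$ is the classical Gauss hypergeometric function). $D_{n,r}$ is the smallest positive integer such that $D_{n,r}X_{n,r}(x)$ has rational integer coefficients. For a positive integer $d$, $N_{d,n,r}$ is the greatest common divisor of the numerators (in lowest terms) of the coefficients of the polynomial $X_{n,r}(1-dx)$. With $v_p$ the $p$-adic valuation, $\mathcal{N}_{d,n}=\prod_{p\mid n}p^{\min(v_p(d),\,v_p(n)+1/(p-1))}$, the product over primes $p$ dividing $n$. It is understood that $g\neq0$, $U(x)\neq 0$, $Z(x)\ne 0$, $U(x)\neq Z(x)$ (so that $W(x)$, $1/W(x)$ and $d$ are defined) and that the denominator of $\mathcal{A}(x)$ is non-zero. *)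

theory Defs
  imports
    "HOL-Complex_Analysis.Complex_Analysis"
    "HOL-Algebra.Generated_Fields"
    "HOL-Algebra.Algebraic_Closure_Type"
begin

text \<open>All number fields are subfields of the complex numbers, represented as subsets of
  the HOL-Algebra ring on the type of complex numbers. In \<open>ring.dimension CC m K L\<close> the set \<open>L\<close>
  has dimension \<open>m\<close> as a vector space over \<open>K\<close>, which for fields says \<open>[L : K] = m\<close>.\<close>

abbreviation CC :: "complex ring" where
  "CC \<equiv> ring_of_type_algebra"

definition adjoin :: "complex set \<Rightarrow> complex \<Rightarrow> complex set" where
  "adjoin K a = generate_field CC (insert a K)"

definition imaginary_quadratic_field :: "complex set \<Rightarrow> bool" where
  "imaginary_quadratic_field K \<longleftrightarrow>
     subfield K CC \<and> ring.dimension CC 2 \<rat> K \<and> \<not> K \<subseteq> \<real>"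

definition conjugates_over :: "complex set \<Rightarrow> complex \<Rightarrow> complex set" where
  "conjugates_over K a = {b. ring.eval CC (ring.Irr CC K a) b = 0}"

text \<open>For \<open>a\<close> of degree at most 2 over \<open>K\<close>, this determines \<open>b\<close>: it is \<open>a\<close> itself
  if \<open>a \<in> K\<close>, and the other root of the minimal polynomial of \<open>a\<close> otherwise.\<close>

definition is_the_conjugate :: "complex set \<Rightarrow> complex \<Rightarrow> complex \<Rightarrow> bool" where
  "is_the_conjugate K a b \<longleftrightarrow> conjugates_over K a = {a, b}"

text \<open>The principal \<open>n\<close>-th root; \<open>Arg\<close> takes values in \<open>(-\<pi>, \<pi>]\<close> and \<open>Arg 0 = 0\<close>.\<close>

definition principal_root :: "nat \<Rightarrow> complex \<Rightarrow> complex" where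
  "principal_root n w = rcis (root n (cmod w)) (Arg w / real n)"

text \<open>The series \<open>\<^sub>2F\<^sub>1(-r, -r - 1/n; 1 - 1/n; x)\<close> terminates: its coefficients beyond
  degree \<open>r\<close> vanish because \<open>pochhammer (-r) k = 0\<close> for \<open>k > r\<close>.\<close>

definition X_poly :: "nat \<Rightarrow> nat \<Rightarrow> rat poly" where
  "X_poly n r =
     (\<Sum>k\<le>r. Polynomial.monom
        (fps_nth (fps_hypergeo [- of_nat r, - of_nat r - 1 / of_nat n] [1 - 1 / of_nat n] 1) k) k)"

definition D_denom :: "nat \<Rightarrow> nat \<Rightarrow> nat" where
  "D_denom n r = (LEAST D. D > 0 \<and> (\<forall>i. of_nat D * poly.coeff (X_poly n r) i \<in> \<int>))"

definition N_num :: "nat \<Rightarrow> nat \<Rightarrow> nat \<Rightarrow> int" where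
  "N_num d n r =
     Gcd (range (\<lambda>i. fst (quotient_of (poly.coeff (pcompose (X_poly n r) [:1, - of_nat d:]) i))))"

definition N_cal :: "nat \<Rightarrow> nat \<Rightarrow> real" where
  "N_cal d n =
     (\<Prod>p\<in>prime_factors n.
        real p powr min (real (multiplicity p d)) (real (multiplicity p n) + 1 / (real p - 1)))"

end

theory Submission
  imports Defs "Jordan_Normal_Form.Char_Poly"
begin

text \<open>Write \<open>w\<close> for the \<open>n\<close>-th root of \<open>W = Z / U\<close>. The hypergeometric polynomials are the diagonal
  Pade approximants of \<open>W powr (1/n)\<close>; homogenised in \<open>Z\<close> and \<open>U\<close> they give \<open>a\<close> and \<open>b\<close> with
  \<open>a - b * w\<close> tiny, and substituting \<open>a / b\<close> for \<open>w\<close> in the Moebius expression of \<open>A\<close> gives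
  approximations \<open>P / Q\<close> of \<open>A\<close>. The remainder is an explicit integral over the segment from 1 to
  \<open>W\<close>. Multiplying by \<open>D / N\<close>, \<open>h / g ^ r\<close> and possibly by a square root of \<open>\<tau>\<close> turns \<open>P\<close> and \<open>Q\<close>
  into algebraic integers of \<open>K\<close>, where nonzero integers have absolute value at least 1. Two
  consecutive approximants are never proportional, so one of them differs from \<open>p / q\<close>, and
  the usual comparison gives the bound.\<close>

section \<open>Algebraic integers form a ring\<close>

text \<open>The factor \<open>cmod (1 - W_root)\<close> in \<open>c\<close> dictates the form of the
  remainder estimate. Bounding the integral by the length of the path would not produce it; the
  comparison has to be with the integral of \<open>t powr (s - 1)\<close> alone, which equals
  \<open>(W powr s - 1) / s\<close>. Passing to moduli under that integral loses a factor that
  depends on how much \<open>Arg t\<close> varies. The two conditions on \<open>W\<close> confine it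
  to the part of the unit disc around 1 with \<open>Re W > 1/2\<close>, where the argument is at
  most \<open>pi / 3\<close> in absolute value, so the loss is at most 3/2. A straight segment is
  used as path because the rest of the kernel is explicit on it; its maximum is the source of the
  quotient \<open>4 * (cmod U - cmod (Z - U)) / (cmod (Z - U))\<^sup>2\<close> in
  \<open>E\<close>.\<close>

lemma algebraic_int_eigenvalue:
  fixes x :: complex and v :: "nat \<Rightarrow> complex" and B :: "nat \<Rightarrow> nat \<Rightarrow> int"
  assumes "i0 < N" "v i0 \<noteq> 0"
    and "\<And>i. i < N \<Longrightarrow> x * v i = (\<Sum>j<N. of_int (B i j) * v j)"
  shows "algebraic_int x"
proof -
  \<comment> \<open>\<open>v\<close> becomes a nonzero eigenvector of an integer matrix, whose
    characteristic polynomial is monic with integer coefficients and has \<open>x\<close> as a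
    root.\<close>
  define M where "M = mat N N (\<lambda>(i, j). B i j)"
  define M' where "M' = map_mat (of_int :: int \<Rightarrow> complex) M"
  have M: "M \<in> carrier_mat N N" and M': "M' \<in> carrier_mat N N"
    by (auto simp: M_def M'_def)
  have "vec N v \<noteq> 0\<^sub>v N"
    using assms(1,2) by (metis index_vec index_zero_vec(1))
  moreover have "M' *\<^sub>v vec N v = x \<cdot>\<^sub>v vec N v"
  proof (rule eq_vecI)
    fix i assume "i < dim_vec (x \<cdot>\<^sub>v vec N v)"
    hence i: "i < N" by simp
    show "(M' *\<^sub>v vec N v) $ i = (x \<cdot>\<^sub>v vec N v) $ i"
      using i assms(3)[OF i]
      by (simp add: M'_def M_def scalar_prod_def atLeast0LessThan)
  qed (simp add: M'_def M_def)
  ultimately have "eigenvector M' (vec N v) x"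
    unfolding eigenvector_def using M' by auto
  hence "poly (char_poly M') x = 0"
    using eigenvalue_root_char_poly[OF M'] by (auto simp: eigenvalue_def)
  hence "poly (map_poly of_int (char_poly M)) x = 0"
    by (simp add: M'_def of_int_hom.char_poly_hom[OF M])
  moreover have "Polynomial.lead_coeff (char_poly M) = 1"
    using degree_monic_char_poly[OF M] by simp
  ultimately show ?thesis
    unfolding algebraic_int_altdef_ipoly by blast
qed

text \<open>\<open>e\<close> is a companion matrix: multiplication by \<open>x\<close> shifts the
  lower powers, and a monic integer polynomial with root \<open>x\<close> rewrites
  \<open>x ^ m\<close>.\<close>

lemma algebraic_int_power_reduce:
  fixes x :: complex
  assumes "algebraic_int x"
  obtains m and e :: "nat \<Rightarrow> nat \<Rightarrow> int" where "m > 0"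
    "\<And>i. i < m \<Longrightarrow> x * x ^ i = (\<Sum>j<m. of_int (e i j) * x ^ j)"
proof -
  obtain p where p: "poly (map_poly of_int p) x = 0" "Polynomial.lead_coeff p = 1"
    using assms by (auto simp: algebraic_int_altdef_ipoly)
  define m where "m = Polynomial.degree p"
  have "m > 0"
  proof (rule ccontr)
    assume "\<not> m > 0"
    then obtain c where "p = [:c:]"
      by (metis degree_eq_zeroE m_def not_gr_zero)
    thus False using p by simp
  qed
  have "0 = (\<Sum>j\<le>m. of_int (poly.coeff p j) * x ^ j)"
    using p(1) by (simp add: poly_altdef m_def degree_map_poly coeff_map_poly)
  also have "\<dots> = x ^ m + (\<Sum>j<m. of_int (poly.coeff p j) * x ^ j)"
    using p(2) by (simp add: m_def lessThan_Suc_atMost[symmetric])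
  finally have red: "x ^ m = (\<Sum>j<m. of_int (- poly.coeff p j) * x ^ j)"
    by (simp add: sum_negf eq_neg_iff_add_eq_0)
  define e where "e = (\<lambda>i j. if Suc i < m then (if j = Suc i then 1 else 0) else - poly.coeff p j)"
  show ?thesis
  proof (rule that[of m e])
    fix i assume i: "i < m"
    show "x * x ^ i = (\<Sum>j<m. of_int (e i j) * x ^ j)"
    proof (cases "Suc i < m")
      case True
      have "(\<Sum>j<m. of_int (e i j) * x ^ j) = (\<Sum>j<m. if j = Suc i then x ^ j else 0)"
        by (intro sum.cong) (auto simp: e_def True)
      thus ?thesis using True by simp
    next
      case False
      hence "Suc i = m" using i by simp
      hence "x * x ^ i = x ^ m" by auto
      thus ?thesis using red False by (simp add: e_def)
    qed
  qed fact
qed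

text \<open>The products \<open>x ^ i * y ^ j\<close> serve as eigenvector; the entry for
  \<open>i = j = 0\<close> is 1, so it is not zero. The pair \<open>(i, j)\<close> is encoded as the
  single index \<open>i * k + j\<close>.\<close>

lemma algebraic_int_bilinear_eigen:
  fixes x y z :: complex and f :: "nat \<Rightarrow> nat \<Rightarrow> nat \<Rightarrow> nat \<Rightarrow> int"
  assumes "m > 0" "k > 0"
    and eq: "\<And>i j. i < m \<Longrightarrow> j < k \<Longrightarrow>
      z * (x ^ i * y ^ j) = (\<Sum>i'<m. \<Sum>j'<k. of_int (f i j i' j') * (x ^ i' * y ^ j'))"
  shows "algebraic_int z"
proof (rule algebraic_int_eigenvalue[of 0 "m * k" "\<lambda>a. x ^ (a div k) * y ^ (a mod k)" z
        "\<lambda>a b. f (a div k) (a mod k) (b div k) (b mod k)"])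
  fix a assume "a < m * k"
  hence a: "a div k < m" "a mod k < k"
    using assms(2) by (auto simp: less_mult_imp_div_less)
  have "z * (x ^ (a div k) * y ^ (a mod k)) =
    (\<Sum>i'<m. \<Sum>j'<k. of_int (f (a div k) (a mod k) i' j') * (x ^ i' * y ^ j'))"
    by (rule eq[OF a])
  also have "\<dots> = (\<Sum>b<m * k. of_int (f (a div k) (a mod k) (b div k) (b mod k)) *
                   (x ^ (b div k) * y ^ (b mod k)))"
    unfolding sum.cartesian_product
  proof (rule sum.reindex_bij_witness[of _ "\<lambda>b. (b div k, b mod k)" "\<lambda>(i, j). i * k + j"])
    fix p assume p: "p \<in> {..<m} \<times> {..<k}"
    show "(case p of (i, j) \<Rightarrow> i * k + j) \<in> {..<m * k}"
    proof (cases p)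
      case (Pair i j)
      hence "i * k + j < (i + 1) * k" "(i + 1) * k \<le> m * k"
        using p by (simp, intro mult_le_mono1) (use p Pair in auto)
      thus ?thesis using Pair by simp
    qed
  qed (auto simp: less_mult_imp_div_less assms)
  finally show "z * (x ^ (a div k) * y ^ (a mod k)) =
    (\<Sum>b<m * k. of_int (f (a div k) (a mod k) (b div k) (b mod k)) *
                   (x ^ (b div k) * y ^ (b mod k)))" .
qed (use assms in auto)

lemma algebraic_int_add [intro]:
  fixes x y :: complex
  assumes "algebraic_int x" "algebraic_int y"
  shows "algebraic_int (x + y)"
proof -
  obtain m e where m: "m > 0" "\<And>i. i < m \<Longrightarrow> x * x ^ i = (\<Sum>j<m. of_int (e i j) * x ^ j)"
    using algebraic_int_power_reduce[OF assms(1)] by metis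
  obtain k e' where k: "k > 0" "\<And>i. i < k \<Longrightarrow> y * y ^ i = (\<Sum>j<k. of_int (e' i j) * y ^ j)"
    using algebraic_int_power_reduce[OF assms(2)] by metis
  \<comment> \<open>Kronecker sum of the two companion matrices: \<open>e\<close> acts on the powers
    of \<open>x\<close>, \<open>e'\<close> on those of \<open>y\<close>.\<close>
  define f where "f = (\<lambda>i j i' j'. (if j' = j then e i i' else 0) + (if i' = i then e' j j' else 0))"
  show ?thesis
  proof (rule algebraic_int_bilinear_eigen[OF m(1) k(1), of "x + y" x y f])
    fix i j assume ij: "i < m" "j < k"
    have "(\<Sum>i'<m. \<Sum>j'<k. of_int (f i j i' j') * (x ^ i' * y ^ j'))
      = (\<Sum>i'<m. \<Sum>j'<k. if j' = j then of_int (e i i') * (x ^ i' * y ^ j') else 0)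
      + (\<Sum>i'<m. \<Sum>j'<k. if i' = i then of_int (e' j j') * (x ^ i' * y ^ j') else 0)"
      unfolding sum.distrib[symmetric] by (intro sum.cong) (auto simp: f_def algebra_simps)
    also have "(\<Sum>i'<m. \<Sum>j'<k. if j' = j then of_int (e i i') * (x ^ i' * y ^ j') else 0)
       = (\<Sum>i'<m. of_int (e i i') * x ^ i') * y ^ j"
      using ij by (simp add: sum_distrib_left sum_distrib_right mult_ac)
    also have "\<dots> = (x * x ^ i) * y ^ j" using m(2) ij by simp
    also have "(\<Sum>i'<m. \<Sum>j'<k. if i' = i then of_int (e' j j') * (x ^ i' * y ^ j') else 0)
       = x ^ i * (\<Sum>j'<k. of_int (e' j j') * y ^ j')"
      using ij by (subst sum.swap) (simp add: sum_distrib_left mult_ac)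
    also have "\<dots> = x ^ i * (y * y ^ j)" using k(2) ij by simp
    finally show "(x + y) * (x ^ i * y ^ j) =
        (\<Sum>i'<m. \<Sum>j'<k. of_int (f i j i' j') * (x ^ i' * y ^ j'))"
      by (simp add: algebra_simps)
  qed
qed

lemma algebraic_int_mult [intro]:
  fixes x y :: complex
  assumes "algebraic_int x" "algebraic_int y"
  shows "algebraic_int (x * y)"
proof -
  obtain m e where m: "m > 0" "\<And>i. i < m \<Longrightarrow> x * x ^ i = (\<Sum>j<m. of_int (e i j) * x ^ j)"
    using algebraic_int_power_reduce[OF assms(1)] by metis
  obtain k e' where k: "k > 0" "\<And>i. i < k \<Longrightarrow> y * y ^ i = (\<Sum>j<k. of_int (e' i j) * y ^ j)"
    using algebraic_int_power_reduce[OF assms(2)] by metis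
  \<comment> \<open>For the product the matrix is the Kronecker product.\<close>
  show ?thesis
  proof (rule algebraic_int_bilinear_eigen[OF m(1) k(1), of "x * y" x y "\<lambda>i j i' j'. e i i' * e' j j'"])
    fix i j assume ij: "i < m" "j < k"
    have "x * y * (x ^ i * y ^ j) = (x * x ^ i) * (y * y ^ j)" by (simp only: mult_ac)
    also have "\<dots> = (\<Sum>i'<m. of_int (e i i') * x ^ i') * (\<Sum>j'<k. of_int (e' j j') * y ^ j')"
      using m(2) k(2) ij by simp
    finally show "x * y * (x ^ i * y ^ j) =
        (\<Sum>i'<m. \<Sum>j'<k. of_int (e i i' * e' j j') * (x ^ i' * y ^ j'))"
      by (simp add: sum_product mult_ac)
  qed
qed

lemma algebraic_int_diff [intro]:
  fixes x y :: complex
  assumes "algebraic_int x" "algebraic_int y"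
  shows "algebraic_int (x - y)"
  using algebraic_int_add[of x "- y"] assms by simp

lemma algebraic_int_power [intro]:
  fixes x :: complex
  shows "algebraic_int x \<Longrightarrow> algebraic_int (x ^ k)"
  by (induction k) auto

lemma algebraic_int_sum [intro]:
  fixes f :: "'a \<Rightarrow> complex"
  shows "(\<And>i. i \<in> I \<Longrightarrow> algebraic_int (f i)) \<Longrightarrow> algebraic_int (sum f I)"
  by (induction I rule: infinite_finite_induct) auto

section \<open>Pade approximants of a power\<close>

text \<open>Partial fractions of the right side in \<open>a\<close>. Pascal's rule turns the sum for
  \<open>Suc r\<close> into the difference of the sums for \<open>r\<close> at \<open>a\<close> and
  \<open>a + 1\<close>. It evaluates the inner sums that termwise integration of the kernel leaves
  behind.\<close>

lemma sum_binomial_partial_fraction: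
  fixes a :: "'a :: field_char_0"
  assumes "\<And>j. j \<le> r \<Longrightarrow> a + of_nat j \<noteq> 0"
  shows "(\<Sum>j\<le>r. (-1) ^ j * of_nat (r choose j) / (a + of_nat j)) = fact r / pochhammer a (Suc r)"
  using assms
proof (induction r arbitrary: a)
  case 0
  thus ?case by simp
next
  case (Suc r)
  have nz: "pochhammer a (Suc (Suc r)) \<noteq> 0"
    using Suc.prems by (auto simp: pochhammer_eq_0_iff eq_neg_iff_add_eq_0)
  have IH1: "(\<Sum>j\<le>r. (-1) ^ j * of_nat (r choose j) / (a + of_nat j)) = fact r / pochhammer a (Suc r)"
    by (rule Suc.IH) (use Suc.prems in auto)
  have IH2: "(\<Sum>j\<le>r. (-1) ^ j * of_nat (r choose j) / (a + 1 + of_nat j)) =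
      fact r / pochhammer (a + 1) (Suc r)"
    by (rule Suc.IH) (use Suc.prems[of "Suc _"] in \<open>auto simp: add_ac\<close>)
  have "(\<Sum>j\<le>Suc r. (-1) ^ j * of_nat (Suc r choose j) / (a + of_nat j)) =
     (\<Sum>j\<le>Suc r. (-1) ^ j * of_nat (r choose j) / (a + of_nat j)) -
     (\<Sum>j\<le>r. (-1) ^ j * of_nat (r choose j) / (a + 1 + of_nat j))"
    by (subst (1 2) sum.atMost_Suc_shift)
       (simp add: sum_subtractf[symmetric] sum.distrib[symmetric] field_simps flip: add_divide_distrib
         del: sum.atMost_Suc)
  also have "\<dots> = fact r / pochhammer a (Suc r) - fact r / pochhammer (a + 1) (Suc r)"
    using IH1 IH2 by simp
  also have "\<dots> = fact r * (a + of_nat (Suc r)) / pochhammer a (Suc (Suc r))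
                 - fact r * a / pochhammer a (Suc (Suc r))"
  proof -
    have "pochhammer a (Suc (Suc r)) = pochhammer a (Suc r) * (a + of_nat (Suc r))"
      by (rule pochhammer_Suc)
    moreover have "pochhammer a (Suc (Suc r)) = a * pochhammer (a + 1) (Suc r)"
      by (rule pochhammer_rec)
    ultimately show ?thesis using nz by (metis mult_divide_mult_cancel_right mult.commute mult_eq_0_iff)
  qed
  also have "\<dots> = fact (Suc r) / pochhammer a (Suc (Suc r))"
    by (simp add: algebra_simps flip: diff_divide_distrib)
  finally show ?case .
qed

text \<open>For \<open>s = 1 / n\<close> this is the coefficient of \<open>X_poly n r\<close>,
  written with the two alternating signs cancelled so that positivity for \<open>0 < s < 1\<close>
  is visible.\<close>

definition pade_coeff :: "real \<Rightarrow> nat \<Rightarrow> nat \<Rightarrow> real" where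
  "pade_coeff s r k =
     real (r choose k) * pochhammer (s + real (r - k) + 1) k / pochhammer (1 - s) k"

lemma pochhammer_one_minus_pos: "s < 1 \<Longrightarrow> pochhammer (1 - s) k > (0::real)"
  by (rule pochhammer_pos) simp

lemma pade_coeff_nonneg: "0 < s \<Longrightarrow> s < 1 \<Longrightarrow> pade_coeff s r k \<ge> 0"
  unfolding pade_coeff_def
  by (intro divide_nonneg_pos mult_nonneg_nonneg pochhammer_one_minus_pos pochhammer_nonneg) auto

text \<open>These are the exponents in the primitive; as none is 0, every term of the expanded
  integrand integrates to a power and never to a logarithm.\<close>

lemma pochhammer_shift_neq_0:
  fixes s :: real
  assumes "0 < s" "s < 1"
  shows "s + real i - real k \<noteq> 0"
proof
  assume "s + real i - real k = 0"
  hence "s = of_int (int k - int i)" by simp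
  with assms have "0 < int k - int i" "int k - int i < 1" by linarith+
  thus False by simp
qed

text \<open>The coefficient of \<open>z ^ k\<close> in \<open>pade_primitive s r z 1\<close>, before
  the normalisation that makes the constant term 1.\<close>

definition pade_term :: "real \<Rightarrow> nat \<Rightarrow> nat \<Rightarrow> real" where
  "pade_term s r k = real (r choose k) * (-1) ^ k *
     (\<Sum>i\<le>r. (-1) ^ i * real (r choose i) / (s + real i - real k))"

text \<open>Partial fractions at \<open>a = s - k\<close>. The first \<open>k\<close> factors of
  \<open>pochhammer (s - k) (Suc r)\<close> are negative and absorb \<open>(-1) ^ k\<close>; the
  remaining ones cancel against \<open>pochhammer s (Suc r)\<close>.\<close>

lemma pade_coeff_conv_partial_fraction:
  fixes s :: real
  assumes s: "0 < s" "s < 1" and k: "k \<le> r"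
  shows "pochhammer s (Suc r) / fact r * pade_term s r k = pade_coeff s r k"
proof -
  have "(\<Sum>i\<le>r. (-1) ^ i * real (r choose i) / (s + real i - real k)) =
        (\<Sum>i\<le>r. (-1) ^ i * real (r choose i) / ((s - real k) + real i))"
    by (simp add: algebra_simps)
  also have "\<dots> = fact r / pochhammer (s - real k) (Suc r)"
    by (rule sum_binomial_partial_fraction)
       (use pochhammer_shift_neq_0[OF s] in \<open>simp add: algebra_simps\<close>)
  finally have 1: "(\<Sum>i\<le>r. (-1) ^ i * real (r choose i) / (s + real i - real k)) =
      fact r / pochhammer (s - real k) (Suc r)" .
  have 2: "pochhammer (s - real k) (Suc r) = pochhammer (s - real k) k * pochhammer s (Suc r - k)"
    using pochhammer_product[of k "Suc r" "s - real k"] k by simp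
  have 3: "pochhammer (s - real k) k = (-1) ^ k * pochhammer (1 - s) k"
    using pochhammer_minus[of "real k - s" k] by (simp add: algebra_simps)
  have 4: "pochhammer s (Suc r) = pochhammer s (Suc r - k) * pochhammer (s + real (r - k) + 1) k"
    using pochhammer_product[of "Suc r - k" "Suc r" s] k by (simp add: Suc_diff_le add_ac)
  have "pochhammer s (Suc r - k) > 0" "pochhammer (1 - s) k > 0"
    by (rule pochhammer_pos, use s in simp)+
  thus ?thesis
    unfolding pade_term_def 1 2 3 4 pade_coeff_def by (simp add: field_simps)
qed

definition pade_X :: "real \<Rightarrow> nat \<Rightarrow> complex \<Rightarrow> complex" where
  "pade_X s r z = (\<Sum>k\<le>r. of_real (pade_coeff s r k) * z ^ k)"

definition pade_Y :: "real \<Rightarrow> nat \<Rightarrow> complex \<Rightarrow> complex" where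
  "pade_Y s r z = (\<Sum>k\<le>r. of_real (pade_coeff s r k) * z ^ (r - k))"

text \<open>The integral over \<open>t\<close> of \<open>t powr (s - 1) * ((1 - t) * (1 - z / t)) ^ r\<close>, expanded
  binomially and integrated termwise.\<close>

definition pade_primitive :: "real \<Rightarrow> nat \<Rightarrow> complex \<Rightarrow> complex \<Rightarrow> complex" where
  "pade_primitive s r z t =
     (\<Sum>k\<le>r. \<Sum>i\<le>r. of_nat (r choose k) * of_nat (r choose i) * (-1) ^ (k + i) * z ^ k *
        (t powr of_real (s + real i - real k) / of_real (s + real i - real k)))"

lemma of_real_mult_sum:
  fixes g :: "'b \<Rightarrow> 'a :: real_algebra_1"
  shows "of_real c * (\<Sum>k\<in>A. of_real (f k) * g k) = (\<Sum>k\<in>A. of_real (c * f k) * g k)"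
  by (simp add: sum_distrib_left mult.assoc)

lemma pade_primitive_1:
  assumes s: "0 < s" "s < 1"
  shows "of_real (pochhammer s (Suc r) / fact r) * pade_primitive s r z 1 = pade_X s r z"
proof -
  have "pade_primitive s r z 1 = (\<Sum>k\<le>r. of_real (pade_term s r k) * z ^ k)"
    unfolding pade_primitive_def pade_term_def
    by (intro sum.cong refl) (simp add: sum_distrib_left sum_distrib_right power_add mult_ac)
  also have "of_real (pochhammer s (Suc r) / fact r) * \<dots> =
     (\<Sum>k\<le>r. of_real (pochhammer s (Suc r) / fact r * pade_term s r k) * z ^ k)"
    by (rule of_real_mult_sum)
  also have "\<dots> = pade_X s r z"
    unfolding pade_X_def by (intro sum.cong refl) (simp only: pade_coeff_conv_partial_fraction[OF s] atMost_iff)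
  finally show ?thesis .
qed

text \<open>At \<open>t = z\<close> the powers of \<open>z\<close> combine to
  \<open>z powr s * z ^ i\<close>, so \<open>i\<close> takes over the role of \<open>k\<close>.
  Reflecting both indices at \<open>r\<close> maps \<open>s + i - k\<close> to the same shape with
  the roles exchanged, which yields the coefficients of \<open>pade_X\<close> in reverse
  order.\<close>

lemma pade_primitive_self:
  assumes s: "0 < s" "s < 1" and z: "z \<noteq> 0"
  shows "of_real (pochhammer s (Suc r) / fact r) * pade_primitive s r z z =
           z powr of_real s * pade_Y s r z"
proof -
  have pw: "z ^ k * z powr of_real (s + real i - real k) = z powr of_real s * z ^ i" for k i
  proof -
    have "z powr of_real (s + real i - real k) = z powr (of_real s + of_nat i) / z powr of_nat k"
      by (subst powr_diff[symmetric]) simp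
    also have "\<dots> = z powr of_real s * z ^ i / z ^ k"
      using z by (simp add: powr_add powr_nat)
    finally show ?thesis using z by simp
  qed
  have "pade_primitive s r z z =
     (\<Sum>k\<le>r. \<Sum>i\<le>r. of_nat (r choose k) * of_nat (r choose i) * (-1) ^ (k + i) *
        (z ^ k * z powr of_real (s + real i - real k)) / of_real (s + real i - real k))"
    unfolding pade_primitive_def by (simp add: mult_ac)
  also have "\<dots> = (\<Sum>i\<le>r. \<Sum>k\<le>r. of_nat (r choose k) * of_nat (r choose i) * (-1) ^ (k + i) *
        (z powr of_real s * z ^ i) / of_real (s + real i - real k))"
    unfolding pw by (rule sum.swap)
  also have "\<dots> = (\<Sum>j\<le>r. \<Sum>l\<le>r. of_nat (r choose l) * of_nat (r choose j) * (-1) ^ (l + j) *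
        (z powr of_real s * z ^ (r - j)) / of_real (s + real l - real j))"
  proof (rule sum.reindex_bij_witness[of _ "\<lambda>j. r - j" "\<lambda>j. r - j"]; (simp; fail)?)
    fix i assume i: "i \<in> {..r}"
    show "(\<Sum>l\<le>r. of_nat (r choose l) * of_nat (r choose (r - i)) * (- 1) ^ (l + (r - i)) *
            (z powr of_real s * z ^ (r - (r - i))) / of_real (s + real l - real (r - i))) =
          (\<Sum>k\<le>r. of_nat (r choose k) * of_nat (r choose i) * (-1) ^ (k + i) *
            (z powr of_real s * z ^ i) / of_real (s + real i - real k))"
    proof (rule sum.reindex_bij_witness[of _ "\<lambda>j. r - j" "\<lambda>j. r - j"]; (simp; fail)?)
      fix l assume l: "l \<in> {..r}"
      have "(-1::complex) ^ (r - l + i) = (-1) ^ (l + (r - i))"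
        using i l by (auto simp: minus_one_power_iff)
      moreover have "r choose (r - l) = r choose l" "r choose (r - i) = r choose i"
        using i l by (simp_all add: binomial_symmetric[symmetric])
      moreover have "s + real i - real (r - l) = s + real l - real (r - i)"
        using i l by (simp add: of_nat_diff)
      ultimately show "of_nat (r choose (r - l)) * of_nat (r choose i) * (- 1) ^ (r - l + i) *
         (z powr of_real s * z ^ i) / of_real (s + real i - real (r - l)) =
         of_nat (r choose l) * of_nat (r choose (r - i)) * (- 1) ^ (l + (r - i)) *
         (z powr of_real s * z ^ (r - (r - i))) / of_real (s + real l - real (r - i))"
        using i by simp
    qed
  qed
  also have "\<dots> = z powr of_real s * (\<Sum>k\<le>r. of_real (pade_term s r k) * z ^ (r - k))"
    unfolding pade_term_def
    by (simp add: sum_distrib_left sum_distrib_right power_add mult_ac)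
  also have "of_real (pochhammer s (Suc r) / fact r) * \<dots> = z powr of_real s *
     (\<Sum>k\<le>r. of_real (pochhammer s (Suc r) / fact r * pade_term s r k) * z ^ (r - k))"
    unfolding mult.left_commute[of _ "z powr of_real s"] by (subst of_real_mult_sum) (rule refl)
  also have "\<dots> = z powr of_real s * pade_Y s r z"
    unfolding pade_Y_def
    by (intro arg_cong2[where f = "(*)"] sum.cong refl)
       (simp only: pade_coeff_conv_partial_fraction[OF s] atMost_iff)
  finally show ?thesis .
qed

lemma pade_remainder:
  assumes "0 < s" "s < 1" "z \<noteq> 0"
  shows "z powr of_real s * pade_Y s r z - pade_X s r z =
    of_real (pochhammer s (Suc r) / fact r) * (pade_primitive s r z z - pade_primitive s r z 1)"
  unfolding right_diff_distrib pade_primitive_1[OF assms(1,2)] pade_primitive_self[OF assms] ..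

text \<open>\<open>Re t > 0\<close> keeps \<open>t\<close> off the branch cut of
  \<open>powr\<close>; the termwise derivatives are then reassembled into the two binomial
  powers.\<close>

lemma has_field_derivative_pade_primitive:
  assumes s: "0 < s" "s < 1" and t: "Re t > 0"
  shows "(pade_primitive s r z has_field_derivative
            t powr of_real (s - 1) * ((1 - t) * (1 - z / t)) ^ r) (at t)"
proof -
  have t0: "t \<noteq> 0" "t \<notin> \<real>\<^sub>\<le>\<^sub>0" using t by (auto simp: complex_nonpos_Reals_iff)
  have "(pade_primitive s r z has_field_derivative
     (\<Sum>k\<le>r. \<Sum>i\<le>r. of_nat (r choose k) * of_nat (r choose i) * (-1) ^ (k + i) * z ^ k *
        (of_real (s + real i - real k) * t powr (of_real (s + real i - real k) - 1)
          / of_real (s + real i - real k)))) (at t)"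
    unfolding pade_primitive_def
    by (intro DERIV_sum DERIV_cmult DERIV_cdivide has_field_derivative_powr t0)
  also have "(\<Sum>k\<le>r. \<Sum>i\<le>r. of_nat (r choose k) * of_nat (r choose i) * (-1) ^ (k + i) * z ^ k *
        (of_real (s + real i - real k) * t powr (of_real (s + real i - real k) - 1)
          / of_real (s + real i - real k))) =
     (\<Sum>k\<le>r. \<Sum>i\<le>r. t powr of_real (s - 1) * (of_nat (r choose k) * (- z / t) ^ k) *
         (of_nat (r choose i) * (- t) ^ i))"
  proof (intro sum.cong refl)
    fix k i
    have "t powr (of_real (s + real i - real k) - 1) = t powr (of_real (s - 1) + of_nat i - of_nat k)"
      by (simp add: algebra_simps)
    also have "\<dots> = t powr of_real (s - 1) * t ^ i / t ^ k"
      using t0 by (simp only: powr_add powr_diff powr_nat') simp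
    finally have *: "t powr (of_real (s + real i - real k) - 1) = t powr of_real (s - 1) * t ^ i / t ^ k" .
    have "of_real (s + real i - real k) \<noteq> (0::complex)"
      using pochhammer_shift_neq_0[OF s, of i k] by (simp only: of_real_eq_0_iff) simp
    thus "of_nat (r choose k) * of_nat (r choose i) * (-1) ^ (k + i) * z ^ k *
        (of_real (s + real i - real k) * t powr (of_real (s + real i - real k) - 1)
          / of_real (s + real i - real k)) =
       t powr of_real (s - 1) * (of_nat (r choose k) * (- z / t) ^ k) *
         (of_nat (r choose i) * (- t) ^ i)"
      unfolding * power_minus[of t] power_divide power_minus[of z] power_add
      by (simp add: mult_ac)
  qed
  also have "\<dots> = t powr of_real (s - 1) * ((\<Sum>k\<le>r. of_nat (r choose k) * (- z / t) ^ k) *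
         (\<Sum>i\<le>r. of_nat (r choose i) * (- t) ^ i))"
    by (subst sum_product) (simp only: sum_distrib_left mult.assoc)
  also have "(\<Sum>k\<le>r. of_nat (r choose k) * (- z / t) ^ k) = (1 - z / t) ^ r"
    using binomial_ring[of "- z / t" 1 r] by simp
  also have "(\<Sum>i\<le>r. of_nat (r choose i) * (- t) ^ i) = (1 - t) ^ r"
    using binomial_ring[of "- t" 1 r] by simp
  finally show ?thesis by (simp add: power_mult_distrib mult_ac)
qed


section \<open>The remainder\<close>

text \<open>The disc and the half-plane meet in a circular segment whose corners have arguments
  \<open>pi / 3\<close> and \<open>- pi / 3\<close>; there the quotient reaches its extreme values,
  plus and minus \<open>sqrt 3\<close>.\<close>

lemma lens_arctan_bound:
  assumes W: "cmod (W - 1) < 1" "Re W > 1/2"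
  shows "\<bar>arctan (Im W / Re W)\<bar> \<le> pi / 3"
proof -
  have "(Re W - 1)\<^sup>2 + (Im W)\<^sup>2 < 1"
    using W(1) by (simp add: cmod_def)
  hence "(Im W)\<^sup>2 < 2 * Re W - (Re W)\<^sup>2" by (simp add: power2_eq_square algebra_simps)
  also have "\<dots> \<le> 3 * (Re W)\<^sup>2"
  proof -
    have "0 \<le> Re W * (2 * Re W - 1)" using W(2) by (intro mult_nonneg_nonneg) auto
    thus ?thesis by (simp add: power2_eq_square algebra_simps)
  qed
  also have "\<dots> = (sqrt 3 * Re W)\<^sup>2" by (simp add: power_mult_distrib)
  finally have "\<bar>Im W\<bar> \<le> \<bar>sqrt 3 * Re W\<bar>" by (simp only: abs_le_square_iff)
  hence "\<bar>Im W / Re W\<bar> \<le> sqrt 3" using W(2) by (simp add: field_simps abs_mult)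
  hence "arctan \<bar>Im W / Re W\<bar> \<le> arctan (sqrt 3)" by (simp add: arctan_le_iff)
  moreover have "arctan (sqrt 3) = pi / 3"
  proof (rule arctan_unique)
    show "- (pi / 2) < pi / 3" using pi_gt_zero by linarith
  qed (simp_all add: tan_60)
  ultimately show ?thesis by (cases "Im W / Re W \<ge> 0") (auto simp: arctan_minus abs_if)
qed

text \<open>The slope \<open>Im t / Re t\<close> is the fraction \<open>u * Re W / Re t\<close>,
  between 0 and 1, of the slope of \<open>W\<close>. Hence \<open>Arg t\<close> lies between 0 and
  \<open>Arg W\<close>, and its distance from the midpoint is at most half of
  \<open>pi / 3\<close>.\<close>

lemma lens_segment_Arg:
  assumes W: "cmod (W - 1) < 1" "Re W > 1/2" and u: "0 \<le> u" "u \<le> 1"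
  shows "\<bar>Arg (1 + of_real u * (W - 1)) - Arg W / 2\<bar> \<le> pi / 6"
proof -
  define t where "t = 1 + of_real u * (W - 1)"
  have Re_t: "Re t = 1 + u * (Re W - 1)" and Im_t: "Im t = u * Im W" by (simp_all add: t_def)
  have "Re t = (1 - u) + u * Re W" by (simp add: Re_t algebra_simps)
  hence Ret: "Re t > 0" "Re t \<ge> u * Re W" 
    using u W(2) by (cases "u = 0"; auto intro: add_nonneg_pos)+
  have q: "Im t / Re t = (u * Re W / Re t) * (Im W / Re W)"
    using W(2) by (simp add: Im_t)
  have q': "0 \<le> u * Re W / Re t" "u * Re W / Re t \<le> 1" using Ret u W(2) by auto
  define y where "y = Im W / Re W"
  have b: "\<bar>arctan y\<bar> \<le> pi / 3" unfolding y_def by (rule lens_arctan_bound[OF W])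
  have eq: "Arg t = arctan (u * Re W / Re t * y)" "Arg W = arctan y"
    using Ret W(2) by (simp_all add: arg_conv_arctan q y_def)
  show ?thesis
  proof (cases "y \<ge> 0")
    case True
    hence "0 \<le> u * Re W / Re t * y" "u * Re W / Re t * y \<le> y"
      using q' by (intro mult_left_le_one_le mult_nonneg_nonneg; simp)+
    hence "0 \<le> Arg t" "Arg t \<le> Arg W"
      unfolding eq by (auto simp: arctan_le_iff)
    thus ?thesis using b unfolding t_def[symmetric] eq by linarith
  next
    case False
    hence "0 \<le> u * Re W / Re t * (- y)" "u * Re W / Re t * (- y) \<le> - y"
      using q' by (intro mult_left_le_one_le mult_nonneg_nonneg; auto)+
    hence "u * Re W / Re t * y \<le> 0" "y \<le> u * Re W / Re t * y" by simp_all
    hence "0 \<ge> Arg t" "Arg t \<ge> Arg W"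
      unfolding eq by (auto simp: arctan_le_iff)
    thus ?thesis using b unfolding t_def[symmetric] eq by linarith
  qed
qed

text \<open>The sharp value \<open>sqrt 3 / 2\<close> is rounded down so that the reciprocal is 3/2:
  with the threshold \<open>2 * cmod q * l < E ^ r\<close> this gives an error below 3/4.\<close>

lemma cos_ge_two_thirds:
  assumes "\<bar>y\<bar> \<le> pi / 6"
  shows "cos y \<ge> 2 / 3"
proof -
  have "cos (pi / 6) \<le> cos \<bar>y\<bar>" using assms by (intro cos_monotone_0_pi_le) auto
  moreover have "sqrt 3 / 2 \<ge> 2 / (3::real)"
    by (rule power2_le_imp_le) (auto simp: power_divide)
  ultimately show ?thesis by (simp add: cos_30)
qed


text \<open>The phase of \<open>t powr (s - 1)\<close> is \<open>(s - 1) * Arg t\<close>. The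
  rotation leaves \<open>(s - 1) * (Arg t - a)\<close>, and the factor \<open>s - 1\<close>, of
  modulus below 1, only shrinks the deviation.\<close>

lemma powr_times_cis_Re_bound:
  assumes t: "t \<noteq> 0" and s: "0 < s" "s < 1" and a: "\<bar>Arg t - a\<bar> \<le> pi / 6"
  shows "Re (cis ((1 - s) * a) * t powr of_real (s - 1)) \<ge> 2 / 3 * cmod (t powr of_real (s - 1))"
proof -
  have "t powr of_real (s - 1) = exp (of_real (s - 1) * (of_real (ln (cmod t)) + \<i> * of_real (Arg t)))"
  proof -
    have "Ln t = of_real (ln (cmod t)) + \<i> * of_real (Arg t)"
      using t by (simp add: complex_eq_iff Arg_eq_Im_Ln)
    thus ?thesis using t by (simp add: powr_def)
  qed
  hence eq: "t powr of_real (s - 1) = of_real (exp ((s - 1) * ln (cmod t))) * cis ((s - 1) * Arg t)"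
    by (simp add: ring_distribs exp_add cis_conv_exp exp_of_real[symmetric] mult_ac)
  have "cis ((1 - s) * a) * cis ((s - 1) * Arg t) = cis ((s - 1) * (Arg t - a))"
    by (simp add: cis_mult algebra_simps)
  hence "Re (cis ((1 - s) * a) * t powr of_real (s - 1)) =
     exp ((s - 1) * ln (cmod t)) * cos ((s - 1) * (Arg t - a))"
    unfolding eq by (subst mult.left_commute) simp
  moreover have "\<bar>(s - 1) * (Arg t - a)\<bar> \<le> 1 * (pi / 6)"
    unfolding abs_mult using s a by (intro mult_mono) auto
  hence "cos ((s - 1) * (Arg t - a)) \<ge> 2 / 3" by (intro cos_ge_two_thirds) simp
  moreover have "cmod (t powr of_real (s - 1)) = exp ((s - 1) * ln (cmod t))"
    unfolding eq by (simp add: norm_mult)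
  ultimately show ?thesis by simp
qed

text \<open>On the segment \<open>(1 - t) * (t - W)\<close> is \<open>u * (1 - u)\<close> times
  \<open>(W - 1)\<^sup>2\<close>, which is largest at the midpoint, while \<open>cmod t\<close>
  stays above \<open>1 - cmod (W - 1)\<close>.\<close>

lemma segment_kernel_bound:
  fixes W :: complex
  assumes W: "cmod (W - 1) < 1" and u: "0 \<le> u" "u \<le> 1"
  defines "t \<equiv> 1 + of_real u * (W - 1)"
  shows "cmod ((1 - t) * (1 - W / t)) \<le> (cmod (W - 1))\<^sup>2 / (4 * (1 - cmod (W - 1)))"
proof -
  define m where "m = cmod (W - 1)"
  have m: "0 \<le> m" "m < 1" using W by (auto simp: m_def)
  have "1 - u * m \<le> cmod t"
    using norm_diff_ineq[of 1 "of_real u * (W - 1)"] u by (simp add: t_def norm_mult m_def)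
  moreover have "u * m \<le> m" using u m by (simp add: mult_left_le_one_le)
  ultimately have t: "1 - m \<le> cmod t" by linarith
  hence t0: "t \<noteq> 0" using m by auto
  have "(1 - t) * (1 - W / t) = (1 - t) * (t - W) / t" using t0 by (simp add: field_simps)
  also have "(1 - t) * (t - W) = of_real (u * (1 - u)) * (W - 1)\<^sup>2"
    by (simp add: t_def power2_eq_square algebra_simps)
  finally have "cmod ((1 - t) * (1 - W / t)) = u * (1 - u) * m\<^sup>2 / cmod t"
    using u by (simp add: norm_mult norm_divide norm_power m_def abs_mult del: of_real_mult of_real_diff)
  also have "\<dots> \<le> (1 / 4) * m\<^sup>2 / (1 - m)"
  proof (intro frac_le mult_right_mono)
    have "0 \<le> (u - 1 / 2)\<^sup>2" by simp
    thus "u * (1 - u) \<le> 1 / 4" by (simp add: power2_eq_square algebra_simps)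
  qed (use t m in auto)
  finally show ?thesis by (simp add: m_def)
qed

text \<open>On the segment from 1 to \<open>W\<close> the argument of \<open>t powr (s - 1)\<close> varies by less than \<open>pi / 3\<close>. After
  rotating by its mean value the real part is at least 2/3 of the modulus, so the integral of
  the modulus exceeds the modulus of the integral, \<open>cmod (W powr s - 1) / s\<close>, by a factor of at most 3/2.\<close>

lemma pade_primitive_bound:
  assumes s: "0 < s" "s < 1" and W: "cmod (W - 1) < 1" "Re W > 1/2"
  shows "cmod (pade_primitive s r W W - pade_primitive s r W 1) \<le>
    3 / 2 * (cmod (W powr of_real s - 1) / s) * ((cmod (W - 1))\<^sup>2 / (4 * (1 - cmod (W - 1)))) ^ r"
proof (cases "W = 1")
  case False
  define B where "B = (cmod (W - 1))\<^sup>2 / (4 * (1 - cmod (W - 1)))"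
  have B: "B \<ge> 0" using W by (simp add: B_def)
  define t where "t = (\<lambda>u::real. 1 + of_real u * (W - 1))"
  \<comment> \<open>The quotient cancels the direction of the segment; the \<open>cis\<close> factor
    centres the phase of \<open>t powr (s - 1)\<close>.\<close>
  define \<omega> where "\<omega> = cnj (W - 1) / of_real (cmod (W - 1)) * cis ((1 - s) * (Arg W / 2))"
  have \<omega>: "cmod \<omega> = 1" using False by (simp add: \<omega>_def norm_mult norm_divide del: complex_cnj_diff)
  have \<omega>W: "\<omega> * (W - 1) = of_real (cmod (W - 1)) * cis ((1 - s) * (Arg W / 2))"
  proof -
    have "cnj (W - 1) * (W - 1) = of_real (cmod (W - 1)) * of_real (cmod (W - 1))"
      using complex_norm_square[of "W - 1"] by (simp add: power2_eq_square mult.commute)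
    moreover have "\<omega> * (W - 1) =
        cnj (W - 1) * (W - 1) / of_real (cmod (W - 1)) * cis ((1 - s) * (Arg W / 2))"
      by (simp only: \<omega>_def mult_ac times_divide_eq_left times_divide_eq_right)
    ultimately show ?thesis using False by (simp del: complex_cnj_diff)
  qed
  define f where "f = (\<lambda>u. pade_primitive s r W (t u))"
  define f' where "f' = (\<lambda>u. (W - 1) * (t u powr of_real (s - 1) * ((1 - t u) * (1 - W / t u)) ^ r))"
  \<comment> \<open>Up to the constant, \<open>g\<close> is the real part of the rotated primitive
    of \<open>t powr (s - 1)\<close>. Since \<open>g'\<close> dominates \<open>cmod (f' u)\<close>,
    a mean value inequality replaces the comparison of the two integrals.\<close>
  define g where "g = (\<lambda>u. 3 / 2 * B ^ r * Re (\<omega> * (t u powr of_real s / of_real s)))"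
  define g' where "g' = (\<lambda>u. 3 / 2 * B ^ r * Re (\<omega> * ((W - 1) * t u powr of_real (s - 1))))"
  have Re_t: "Re (t u) > 0" if "0 \<le> u" "u \<le> 1" for u
  proof -
    have "Re (t u) = (1 - u) + u * Re W" by (simp add: t_def algebra_simps)
    moreover have "0 \<le> u * Re W" "u = 1 \<Longrightarrow> u * Re W > 0" using that W(2) by auto
    ultimately show ?thesis using that by (cases "u = 1") auto
  qed
  have dt: "(t has_vector_derivative (W - 1)) (at u)" for u
    unfolding t_def by (auto intro!: derivative_eq_intros)
  have df: "(f has_vector_derivative f' u) (at u)" if "0 \<le> u" "u \<le> 1" for u
    unfolding f_def f'_def
    using field_vector_diff_chain_at[OF dt has_field_derivative_pade_primitive[OF s Re_t[OF that]]]
    by (simp add: o_def)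
  have dpw: "((\<lambda>u. t u powr of_real s / of_real s) has_vector_derivative
      ((W - 1) * t u powr of_real (s - 1))) (at u)" if "0 \<le> u" "u \<le> 1" for u
  proof -
    have "t u \<notin> \<real>\<^sub>\<le>\<^sub>0" using Re_t[OF that] by (auto simp: complex_nonpos_Reals_iff)
    hence "((\<lambda>z. z powr of_real s / of_real s) has_field_derivative
              of_real s * t u powr (of_real s - 1) / of_real s) (at (t u))"
      by (intro DERIV_cdivide has_field_derivative_powr)
    from field_vector_diff_chain_at[OF dt this] show ?thesis using s by (simp add: o_def)
  qed
  have dg: "(g has_vector_derivative g' u) (at u)" if "0 \<le> u" "u \<le> 1" for u
    unfolding g_def g'_def
    by (intro has_vector_derivative_mult_right
          bounded_linear.has_vector_derivative[OF bounded_linear_Re] dpw[OF that])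
  have le: "cmod (f' u) \<le> g' u" if u: "0 \<le> u" "u \<le> 1" for u
  proof -
    have "cmod (f' u) \<le> cmod (W - 1) * (cmod (t u powr of_real (s - 1)) * B ^ r)"
      unfolding f'_def norm_mult norm_power B_def t_def
      using segment_kernel_bound[OF W(1) u]
      by (intro mult_left_mono power_mono) (auto simp: norm_mult)
    also have "\<dots> = 3 / 2 * B ^ r * cmod (W - 1) * (2 / 3 * cmod (t u powr of_real (s - 1)))"
      by simp
    also have "\<dots> \<le> 3 / 2 * B ^ r * cmod (W - 1) *
        Re (cis ((1 - s) * (Arg W / 2)) * t u powr of_real (s - 1))"
    proof (intro mult_left_mono powr_times_cis_Re_bound s)
      show "t u \<noteq> 0" using Re_t[OF u] by auto
      show "\<bar>Arg (t u) - Arg W / 2\<bar> \<le> pi / 6"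
        using lens_segment_Arg[OF W u] by (simp add: t_def)
    qed (use B in auto)
    also have "\<dots> = g' u"
    proof -
      have "\<omega> * ((W - 1) * t u powr of_real (s - 1)) =
          of_real (cmod (W - 1)) * (cis ((1 - s) * (Arg W / 2)) * t u powr of_real (s - 1))"
        by (simp only: mult.assoc[symmetric] \<omega>W)
      moreover have "Re (of_real c * z) = c * Re z" for c z by simp
      ultimately show ?thesis by (simp only: g'_def mult.assoc)
    qed
    finally show ?thesis .
  qed
  have "cmod (f 1 - f 0) \<le> g 1 - g 0"
  proof (rule differentiable_bound_general[where f' = f' and \<phi>' = g'])
    show "continuous_on {0..1} f" "continuous_on {0..1} g"
      by (auto intro!: continuous_at_imp_continuous_on has_vector_derivative_continuous[OF df]
            has_vector_derivative_continuous[OF dg])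
  qed (use df dg le in auto)
  also have "g 1 - g 0 = 3 / 2 * B ^ r * Re (\<omega> * ((W powr of_real s - 1) / of_real s))"
    by (simp add: g_def t_def algebra_simps diff_divide_distrib)
  also have "\<dots> \<le> 3 / 2 * B ^ r * cmod (\<omega> * ((W powr of_real s - 1) / of_real s))"
    using B by (intro mult_left_mono complex_Re_le_cmod) auto
  also have "cmod (\<omega> * ((W powr of_real s - 1) / of_real s)) = cmod (W powr of_real s - 1) / s"
    using s by (simp add: norm_mult norm_divide \<omega>)
  finally show ?thesis by (simp add: f_def t_def B_def mult_ac)
qed simp

lemma pade_remainder_bound:
  assumes s: "0 < s" "s < 1" and W: "cmod (W - 1) < 1" "Re W > 1/2"
  shows "cmod (W powr of_real s * pade_Y s r W - pade_X s r W) \<le>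
    3 / 2 * (pochhammer s (Suc r) / (s * fact r)) * cmod (W powr of_real s - 1) *
      ((cmod (W - 1))\<^sup>2 / (4 * (1 - cmod (W - 1)))) ^ r"
proof -
  have "W \<noteq> 0" using W(2) by auto
  have p: "pochhammer s (Suc r) / fact r \<ge> 0" using s by (intro divide_nonneg_pos pochhammer_nonneg) auto
  have "cmod (W powr of_real s * pade_Y s r W - pade_X s r W) =
     pochhammer s (Suc r) / fact r * cmod (pade_primitive s r W W - pade_primitive s r W 1)"
    unfolding pade_remainder[OF s \<open>W \<noteq> 0\<close>] norm_mult norm_of_real abs_of_nonneg[OF p] ..
  also have "\<dots> \<le> pochhammer s (Suc r) / fact r *
     (3 / 2 * (cmod (W powr of_real s - 1) / s) * ((cmod (W - 1))\<^sup>2 / (4 * (1 - cmod (W - 1)))) ^ r)"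
    by (intro mult_left_mono pade_primitive_bound s W p)
  finally show ?thesis by (simp add: mult_ac)
qed

section \<open>Size and independence of the approximants\<close>

lemma pochhammer_mono:
  fixes a b :: real
  assumes "0 \<le> a" "a \<le> b"
  shows "pochhammer a k \<le> pochhammer b k"
  unfolding pochhammer_prod using assms by (intro prod_mono) auto

text \<open>By Pascal's rule the left side is a sum of two distinct entries of row \<open>r\<close>,
  so the sum of that row suffices; the row \<open>Suc r\<close> would cost another factor 2.\<close>

lemma binomial_Suc_le_power2: "k \<le> r \<Longrightarrow> Suc r choose k \<le> 2 ^ r"
proof (cases k)
  case (Suc j)
  assume "k \<le> r"
  hence "(r choose j) + (r choose k) = (\<Sum>i\<in>{j, k}. r choose i)" using Suc by simp
  also have "\<dots> \<le> (\<Sum>i\<le>r. r choose i)"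
    using \<open>k \<le> r\<close> Suc by (intro sum_mono2) auto
  also have "\<dots> = 2 ^ r" by (rule choose_row_sum)
  finally show ?thesis using Suc by simp
qed simp

text \<open>Over the common denominator \<open>pochhammer (1 - s) r\<close> the numerator has one
  factor increasing and one decreasing in \<open>s\<close>. Replacing \<open>s\<close> by 1 in the
  first and by 0 in the second leaves factorials only.\<close>

lemma pade_coeff_le:
  assumes s: "0 < s" "s < 1" and k: "k \<le> r"
  shows "pade_coeff s r k \<le> fact r / pochhammer (1 - s) r * (real (r choose k) * 2 ^ r)"
proof -
  have pos: "pochhammer (1 - s) k > 0" "pochhammer (1 - s) r > 0"
    using s by (auto intro: pochhammer_one_minus_pos)
  have split: "pochhammer (1 - s) r = pochhammer (1 - s) k * pochhammer (1 - s + real k) (r - k)"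
    by (rule pochhammer_product[OF k])
  have "pochhammer (s + real (r - k) + 1) k * pochhammer (1 - s + real k) (r - k) \<le>
        pochhammer (real (r - k) + 2) k * pochhammer (1 + real k) (r - k)"
    using s by (intro mult_mono pochhammer_mono pochhammer_nonneg) auto
  also have "\<dots> = fact r * real (Suc r choose k)"
  proof -
    have "pochhammer (real (r - k) + 2) k = fact (Suc r) / fact (Suc r - k)"
    proof -
      have "fact (Suc r) = (fact (Suc r - k) :: real) * pochhammer (1 + real (Suc r - k)) k"
        using pochhammer_product[of "Suc r - k" "Suc r" "1::real"] k
        unfolding pochhammer_fact[symmetric] by simp
      moreover have "1 + real (Suc r - k) = real (r - k) + 2" using k by (simp add: Suc_diff_le)
      ultimately show ?thesis by (simp add: add_ac del: fact_Suc)
    qed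
    moreover have "pochhammer (1 + real k) (r - k) = fact r / fact k"
      using pochhammer_product[of k r "1::real"] k by (simp add: pochhammer_fact[symmetric] field_simps)
    ultimately show ?thesis
      using binomial_fact[of k "Suc r", where 'a = real] k by (simp add: mult_ac)
  qed
  also have "\<dots> \<le> fact r * 2 ^ r"
    using binomial_Suc_le_power2[OF k] of_nat_le_iff[of "Suc r choose k" "2 ^ r", where 'a = real]
    by (intro mult_left_mono) auto
  finally have *: "pochhammer (s + real (r - k) + 1) k * pochhammer (1 - s + real k) (r - k) \<le> fact r * 2 ^ r" .
  have "pade_coeff s r k = real (r choose k) *
     (pochhammer (s + real (r - k) + 1) k * pochhammer (1 - s + real k) (r - k)) / pochhammer (1 - s) r"
    using pos unfolding pade_coeff_def split by (auto simp: field_simps)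
  also have "\<dots> \<le> real (r choose k) * (fact r * 2 ^ r) / pochhammer (1 - s) r"
    using pos by (intro divide_right_mono mult_left_mono *) auto
  finally show ?thesis by (simp add: mult_ac)
qed

text \<open>Homogenisation of degree \<open>r\<close>. Exchanging \<open>z\<close> and
  \<open>u\<close> reverses the coefficients, so the same form serves \<open>pade_X\<close> and
  \<open>pade_Y\<close>.\<close>

definition pade_form :: "real \<Rightarrow> nat \<Rightarrow> complex \<Rightarrow> complex \<Rightarrow> complex" where
  "pade_form s r z u = (\<Sum>k\<le>r. of_real (pade_coeff s r k) * z ^ k * u ^ (r - k))"

lemma pade_form_conv_X: "u \<noteq> 0 \<Longrightarrow> pade_form s r z u = u ^ r * pade_X s r (z / u)"
  unfolding pade_form_def pade_X_def sum_distrib_left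
  by (intro sum.cong refl) (auto simp: power_divide power_diff field_simps)

lemma pade_form_conv_Y: "u \<noteq> 0 \<Longrightarrow> pade_form s r u z = u ^ r * pade_Y s r (z / u)"
  unfolding pade_form_def pade_Y_def sum_distrib_left
  by (intro sum.cong refl) (auto simp: power_divide power_diff field_simps)

text \<open>The binomial weights sum to a power of \<open>cmod u + cmod z\<close>, the source of
  \<open>2 * (cmod U + cmod Z)\<close> in \<open>Q\<close>; the quotient in front is the first Gamma
  quotient in the hypothesis on \<open>Cn\<close>.\<close>

lemma norm_pade_form_le:
  assumes s: "0 < s" "s < 1"
  shows "cmod (pade_form s r z u) \<le> fact r / pochhammer (1 - s) r * (2 * (cmod u + cmod z)) ^ r"
proof -
  have "cmod (pade_form s r z u) \<le>
    (\<Sum>k\<le>r. fact r / pochhammer (1 - s) r * (real (r choose k) * 2 ^ r) * (cmod z ^ k * cmod u ^ (r - k)))"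
    unfolding pade_form_def
  proof (rule order_trans[OF norm_sum], intro sum_mono)
    fix k assume "k \<in> {..r}"
    hence k: "k \<le> r" by simp
    have "cmod (of_real (pade_coeff s r k) * z ^ k * u ^ (r - k)) =
        pade_coeff s r k * (cmod z ^ k * cmod u ^ (r - k))"
      using pade_coeff_nonneg[OF s] by (simp add: norm_mult norm_power)
    also have "\<dots> \<le> fact r / pochhammer (1 - s) r * (real (r choose k) * 2 ^ r) * (cmod z ^ k * cmod u ^ (r - k))"
      by (intro mult_right_mono pade_coeff_le s k) auto
    finally show "cmod (of_real (pade_coeff s r k) * z ^ k * u ^ (r - k)) \<le> \<dots>" .
  qed
  also have "\<dots> = fact r / pochhammer (1 - s) r * 2 ^ r *
      (\<Sum>k\<le>r. real (r choose k) * cmod z ^ k * cmod u ^ (r - k))"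
    by (simp add: sum_distrib_left mult_ac)
  also have "(\<Sum>k\<le>r. real (r choose k) * cmod z ^ k * cmod u ^ (r - k)) = (cmod u + cmod z) ^ r"
    using binomial_ring[of "cmod z" "cmod u" r] by (simp add: add.commute)
  finally show ?thesis by (simp only: power_mult_distrib mult_ac times_divide_eq_left times_divide_eq_right)
qed

text \<open>For a polynomial the order of vanishing can be tested along positive reals: the limit at
  0 kills the constant coefficient, and dividing by \<open>y\<close> lowers \<open>m\<close> by
  one.\<close>

lemma coeff_eq_0_if_O_power:
  fixes q :: "complex poly"
  assumes "\<delta> > 0" and "\<And>y::real. 0 < y \<Longrightarrow> y < \<delta> \<Longrightarrow> cmod (poly q (of_real y)) \<le> C * y ^ m"
  shows "i < m \<Longrightarrow> poly.coeff q i = 0"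
  using assms(2)
proof (induction m arbitrary: q i)
  case (Suc m)
  obtain a q' where q: "q = pCons a q'" by (cases q)
  have ev: "\<forall>\<^sub>F y in at_right 0. (y::real) \<in> {0<..<\<delta>}"
    using \<open>\<delta> > 0\<close> by (rule eventually_at_right_real)
  have "((\<lambda>y. poly q (of_real y)) \<longlongrightarrow> 0) (at_right (0::real))"
  proof (rule Lim_null_comparison)
    show "\<forall>\<^sub>F y in at_right 0. cmod (poly q (of_real y)) \<le> C * y ^ Suc m"
      using ev by eventually_elim (use Suc.prems in auto)
    have "((\<lambda>y::real. C * y ^ Suc m) \<longlongrightarrow> C * 0 ^ Suc m) (at_right 0)"
      by (intro tendsto_intros)
    thus "((\<lambda>y::real. C * y ^ Suc m) \<longlongrightarrow> 0) (at_right 0)" by simp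
  qed
  moreover have "((\<lambda>y. poly q (of_real y)) \<longlongrightarrow> poly q (of_real 0)) (at_right (0::real))"
    by (intro tendsto_intros)
  ultimately have "poly q 0 = 0"
    using tendsto_unique[OF trivial_limit_at_right_real] by force
  hence a: "a = 0" by (simp add: q)
  have q': "cmod (poly q' (of_real y)) \<le> C * y ^ m" if "0 < y" "y < \<delta>" for y :: real
    using Suc.prems(2)[of y] that by (simp add: q a norm_mult mult.left_commute)
  show ?case
  proof (cases i)
    case 0
    thus ?thesis by (simp add: q a)
  next
    case (Suc j)
    thus ?thesis using Suc.IH[OF _ q', of j] Suc.prems(1) by (simp add: q)
  qed
qed simp

definition pade_X_poly :: "real \<Rightarrow> nat \<Rightarrow> complex poly" where
  "pade_X_poly s r = (\<Sum>k\<le>r. Polynomial.monom (of_real (pade_coeff s r k)) k)"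

definition pade_Y_poly :: "real \<Rightarrow> nat \<Rightarrow> complex poly" where
  "pade_Y_poly s r = (\<Sum>k\<le>r. Polynomial.monom (of_real (pade_coeff s r k)) (r - k))"

lemma poly_pade [simp]:
  "poly (pade_X_poly s r) z = pade_X s r z" "poly (pade_Y_poly s r) z = pade_Y s r z"
  by (simp_all add: pade_X_poly_def pade_Y_poly_def pade_X_def pade_Y_def poly_sum poly_monom)

lemma degree_pade_le:
  "Polynomial.degree (pade_X_poly s r) \<le> r" "Polynomial.degree (pade_Y_poly s r) \<le> r"
  unfolding pade_X_poly_def pade_Y_poly_def
  by (intro degree_sum_le order_trans[OF degree_monom_le]; simp)+

lemma pade_0 [simp]: "pade_X s r 0 = 1" "pade_Y s r 0 = of_real (pade_coeff s r r)"
proof -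
  have "pade_X s r 0 = (\<Sum>k\<le>r. if k = 0 then of_real (pade_coeff s r k) else 0)"
    unfolding pade_X_def by (intro sum.cong) auto
  thus "pade_X s r 0 = 1" by (simp add: pade_coeff_def)
  have "pade_Y s r 0 = (\<Sum>k\<le>r. if k = r then of_real (pade_coeff s r k) else 0)"
    unfolding pade_Y_def by (intro sum.cong) auto
  thus "pade_Y s r 0 = of_real (pade_coeff s r r)" by simp
qed

text \<open>At 0 every \<open>pade_X\<close> is 1 and \<open>pade_Y\<close> is its leading
  coefficient \<open>pade_coeff s r r\<close>, so this inequality keeps the determinant of
  consecutive approximants from vanishing there.\<close>

lemma pade_lead_less:
  assumes s: "0 < s" "s < 1"
  shows "pade_coeff s r r < pade_coeff s (Suc r) (Suc r)"
proof -
  have pos: "pochhammer (1 - s) r > 0" "pochhammer (s + 1) r > 0"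
    using s by (auto intro: pochhammer_pos)
  have "pade_coeff s (Suc r) (Suc r) = pade_coeff s r r * ((s + 1 + real r) / (1 - s + real r))"
    by (simp add: pade_coeff_def pochhammer_Suc)
  moreover have "(s + 1 + real r) / (1 - s + real r) > 1" using s by (simp add: field_simps)
  moreover have "pade_coeff s r r > 0" using pos by (simp add: pade_coeff_def)
  ultimately show ?thesis by (metis mult_less_cancel_left_pos mult.right_neutral)
qed

lemma norm_pade_Y_le:
  assumes s: "0 < s" "s < 1" and z: "cmod z \<le> 2"
  shows "cmod (pade_Y s r z) \<le> (\<Sum>k\<le>r. pade_coeff s r k * 2 ^ (r - k))"
  unfolding pade_Y_def
proof (rule order_trans[OF norm_sum], intro sum_mono)
  fix k
  show "cmod (of_real (pade_coeff s r k) * z ^ (r - k)) \<le> pade_coeff s r k * 2 ^ (r - k)"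
    using pade_coeff_nonneg[OF s, of r k] power_mono[OF z, of "r - k"]
    by (simp add: norm_mult norm_power mult_left_mono)
qed

lemma pade_remainder_real_O:
  assumes s: "0 < s" "s < 1"
  obtains C where "\<And>y. 0 < y \<Longrightarrow> y < 1 / 2 \<Longrightarrow>
    cmod ((1 + of_real y) powr of_real s * pade_Y s r (1 + of_real y) - pade_X s r (1 + of_real y))
      \<le> C * y ^ (2 * r + 1)"
proof
  fix y :: real assume y: "0 < y" "y < 1 / 2"
  define c where "c = 3 / 2 * (pochhammer s (Suc r) / (s * fact r))"
  have c: "c \<ge> 0" unfolding c_def using s
    by (intro mult_nonneg_nonneg divide_nonneg_pos pochhammer_nonneg) auto
  have *: "cmod ((1 + of_real y) powr of_real s - 1) \<le> y"
  proof -
    have "(1 + complex_of_real y) powr of_real s = of_real ((1 + y) powr s)"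
      using powr_of_real[of "1 + y" s] y by simp
    hence "cmod ((1 + of_real y) powr of_real s - 1) = \<bar>(1 + y) powr s - 1\<bar>"
      by (metis norm_of_real of_real_1 of_real_diff)
    also have "\<dots> = (1 + y) powr s - 1" using y s ge_one_powr_ge_zero[of "1 + y" s] by simp
    also have "(1 + y) powr s \<le> (1 + y) powr 1" using y s by (intro powr_mono) auto
    finally show ?thesis using y by simp
  qed
  have "cmod ((1 + of_real y) powr of_real s * pade_Y s r (1 + of_real y) - pade_X s r (1 + of_real y))
     \<le> c * cmod ((1 + of_real y) powr of_real s - 1) * (y\<^sup>2 / (4 * (1 - y))) ^ r"
    using pade_remainder_bound[OF s, of "1 + of_real y" r] y unfolding c_def by simp
  also have "\<dots> \<le> c * y * (y\<^sup>2) ^ r"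
  proof (intro mult_mono power_mono * mult_left_mono)
    show "y\<^sup>2 / (4 * (1 - y)) \<le> y\<^sup>2"
      using y by (subst pos_divide_le_eq) (auto intro!: mult_left_le simp: algebra_simps)
  qed (use y c in auto)
  also have "\<dots> = c * y ^ (2 * r + 1)" by (simp add: power_mult)
  finally show "cmod ((1 + of_real y) powr of_real s * pade_Y s r (1 + of_real y) - pade_X s r (1 + of_real y))
      \<le> 3 / 2 * (pochhammer s (Suc r) / (s * fact r)) * y ^ (2 * r + 1)" by (simp only: c_def)
qed

text \<open>The determinant has degree at most \<open>2 * r + 1\<close> and vanishes to that order at 1, so
  it is a constant multiple of \<open>(z - 1) ^ (2 * r + 1)\<close>; the constant is read off at 0.\<close>

lemma pade_det_neq_0:
  assumes s: "0 < s" "s < 1" and z: "z \<noteq> 1"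
  shows "pade_X s r z * pade_Y s (Suc r) z \<noteq> pade_X s (Suc r) z * pade_Y s r z"
proof
  assume eq: "pade_X s r z * pade_Y s (Suc r) z = pade_X s (Suc r) z * pade_Y s r z"
  define T where "T = pade_X_poly s r * pade_Y_poly s (Suc r) - pade_X_poly s (Suc r) * pade_Y_poly s r"
  define q where "q = pcompose T [:1, 1:]"
  define m where "m = 2 * r + 1"
  have poly_q: "poly q y = poly T (1 + y)" for y by (simp add: q_def poly_pcompose)
  have "Polynomial.degree T \<le> m"
    unfolding T_def m_def
    by (intro degree_diff_le order_trans[OF degree_mult_le]
          order_trans[OF add_mono[OF degree_pade_le(1) degree_pade_le(2)]]) auto
  hence deg: "Polynomial.degree q \<le> m"
    using degree_pcompose_le[of T "[:1, 1:]"] by (simp add: q_def)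
  obtain C1 where C1: "\<And>y. 0 < y \<Longrightarrow> y < 1 / 2 \<Longrightarrow>
    cmod ((1 + of_real y) powr of_real s * pade_Y s r (1 + of_real y) - pade_X s r (1 + of_real y))
      \<le> C1 * y ^ (2 * r + 1)" using pade_remainder_real_O[OF s] by blast
  obtain C2 where C2: "\<And>y. 0 < y \<Longrightarrow> y < 1 / 2 \<Longrightarrow>
    cmod ((1 + of_real y) powr of_real s * pade_Y s (Suc r) (1 + of_real y) - pade_X s (Suc r) (1 + of_real y))
      \<le> C2 * y ^ (2 * Suc r + 1)" using pade_remainder_real_O[OF s] by blast
  define Y where "Y = (\<lambda>r. \<Sum>k\<le>r. pade_coeff s r k * 2 ^ (r - k))"
  have Y: "Y r \<ge> 0" for r unfolding Y_def using pade_coeff_nonneg[OF s] by (intro sum_nonneg) auto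
  have bnd: "cmod (poly q (of_real y)) \<le> (\<bar>C2\<bar> * Y r + \<bar>C1\<bar> * Y (Suc r)) * y ^ m"
    if y: "0 < y" "y < 1 / 2" for y :: real
  proof -
    define w where "w = 1 + complex_of_real y"
    define R where "R = (\<lambda>r. w powr of_real s * pade_Y s r w - pade_X s r w)"
    have w: "cmod w \<le> 2" unfolding w_def using y norm_triangle_ineq[of 1 "of_real y :: complex"] by simp
    \<comment> \<open>Writing each \<open>pade_X\<close> as \<open>w powr s * pade_Y\<close> minus
      its remainder makes the products of two \<open>pade_Y\<close> cancel; the order of the
      determinant is then that of the weaker remainder \<open>R r\<close>.\<close>
    have "poly q (of_real y) = R (Suc r) * pade_Y s r w - R r * pade_Y s (Suc r) w"
      by (simp add: poly_q T_def R_def w_def algebra_simps)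
    also have "cmod \<dots> \<le> cmod (R (Suc r)) * cmod (pade_Y s r w) + cmod (R r) * cmod (pade_Y s (Suc r) w)"
      by (metis norm_triangle_ineq4 norm_mult)
    also have "\<dots> \<le> (\<bar>C2\<bar> * y ^ m) * Y r + (\<bar>C1\<bar> * y ^ m) * Y (Suc r)"
    proof (intro add_mono mult_mono)
      have "cmod (R (Suc r)) \<le> C2 * y ^ (2 * Suc r + 1)" using C2[OF y] by (simp add: R_def w_def)
      also have "\<dots> \<le> \<bar>C2\<bar> * y ^ (2 * Suc r + 1)" using y by (intro mult_right_mono) auto
      also have "\<dots> \<le> \<bar>C2\<bar> * y ^ m" using y by (intro mult_left_mono power_decreasing) (auto simp: m_def)
      finally show "cmod (R (Suc r)) \<le> \<bar>C2\<bar> * y ^ m" .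
      have "cmod (R r) \<le> C1 * y ^ m" using C1[OF y] by (simp add: R_def w_def m_def)
      also have "\<dots> \<le> \<bar>C1\<bar> * y ^ m" using y by (intro mult_right_mono) auto
      finally show "cmod (R r) \<le> \<bar>C1\<bar> * y ^ m" .
    qed (use y norm_pade_Y_le[OF s w] in \<open>auto simp: Y_def simp del: sum.atMost_Suc\<close>)
    finally show ?thesis by (simp add: algebra_simps)
  qed
  have low: "poly.coeff q i = 0" if "i < m" for i
    by (rule coeff_eq_0_if_O_power[where \<delta> = "1 / 2", OF _ bnd that]) auto
  have q: "q = Polynomial.monom (poly.coeff q m) m"
  proof (rule poly_eqI)
    fix i show "poly.coeff q i = poly.coeff (Polynomial.monom (poly.coeff q m) m) i"
      using low[of i] deg coeff_eq_0[of q i] by (cases i m rule: linorder_cases) auto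
  qed
  have T: "poly T y = poly.coeff q m * (y - 1) ^ m" for y
    using poly_q[of "y - 1"] arg_cong[OF q, of "\<lambda>p. poly p (y - 1)"] by (simp add: poly_monom)
  have "poly T 0 = of_real (pade_coeff s (Suc r) (Suc r) - pade_coeff s r r)" by (simp add: T_def)
  also have "\<dots> \<noteq> 0" using pade_lead_less[OF s, of r] by (simp only: of_real_eq_0_iff)
  finally have "poly.coeff q m \<noteq> 0" unfolding T by auto
  moreover have "poly T z = 0" using eq by (simp add: T_def)
  ultimately show False using z unfolding T by simp
qed

section \<open>Subfields and conjugates\<close>

lemma CC_simps [simp]:
  "carrier CC = UNIV" "a \<otimes>\<^bsub>CC\<^esub> b = a * b" "\<one>\<^bsub>CC\<^esub> = 1" "\<zero>\<^bsub>CC\<^esub> = 0" "a \<oplus>\<^bsub>CC\<^esub> b = a + b"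
  by (simp_all add: ring_of_type_algebra_def)

lemma field_CC: "field CC" by (rule field_from_type_algebra)

lemma ring_CC: "ring CC" by (rule ring_from_type_algebra)

lemma domain_CC: "domain CC" using field_CC by (simp add: field_def)

lemma CC_a_inv [simp]: "\<ominus>\<^bsub>CC\<^esub> a = - a"
proof -
  interpret field CC by (rule field_CC)
  show ?thesis by (rule minus_equality) auto
qed

lemma CC_m_inv: "a \<noteq> 0 \<Longrightarrow> inv\<^bsub>CC\<^esub> a = inverse a"
proof -
  interpret field CC by (rule field_CC)
  show "a \<noteq> 0 \<Longrightarrow> ?thesis" by (rule comm_inv_char) auto
qed

lemma CC_pow [simp]: "a [^]\<^bsub>CC\<^esub> (k::nat) = a ^ k"
proof -
  interpret field CC by (rule field_CC)
  show ?thesis by (induction k) (auto simp: mult.commute)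
qed

lemma subfield_CCI:
  assumes "0 \<in> K" "1 \<in> K" "\<And>a b. a \<in> K \<Longrightarrow> b \<in> K \<Longrightarrow> a + b \<in> K"
    "\<And>a b. a \<in> K \<Longrightarrow> b \<in> K \<Longrightarrow> a * b \<in> K" "\<And>a. a \<in> K \<Longrightarrow> - a \<in> K"
    "\<And>a. a \<in> K \<Longrightarrow> inverse a \<in> K"
  shows "subfield K CC"
proof -
  interpret field CC by (rule field_CC)
  show ?thesis
    by (rule subfieldI') (use assms in \<open>auto intro!: subringI simp: CC_m_inv\<close>)
qed

section \<open>Subfields of the complex numbers, extensions of degree 1 and 2, conjugates\<close>

locale complex_subfield =
  fixes K :: "complex set"
  assumes subfield: "subfield K CC"
begin

lemma zero_mem [simp, intro]: "0 \<in> K" and one_mem [simp, intro]: "1 \<in> K"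
  and add_mem [intro]: "a \<in> K \<Longrightarrow> b \<in> K \<Longrightarrow> a + b \<in> K"
  and mult_mem [intro]: "a \<in> K \<Longrightarrow> b \<in> K \<Longrightarrow> a * b \<in> K"
  and minus_mem [intro]: "a \<in> K \<Longrightarrow> - a \<in> K"
  using subringE[OF subfieldE(1)[OF subfield]] by auto

lemma diff_mem [intro]: "a \<in> K \<Longrightarrow> b \<in> K \<Longrightarrow> a - b \<in> K"
  using add_mem[of a "- b"] by auto

lemma inverse_mem [intro]: "a \<in> K \<Longrightarrow> inverse a \<in> K"
  using ring.subfield_m_inv(1)[OF ring_CC subfield, of a] by (cases "a = 0") (auto simp: CC_m_inv)

lemma divide_mem [intro]: "a \<in> K \<Longrightarrow> b \<in> K \<Longrightarrow> a / b \<in> K"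
  unfolding divide_inverse by auto

lemma power_mem [intro]: "a \<in> K \<Longrightarrow> a ^ k \<in> K"
  by (induction k) auto

lemma sum_mem [intro]: "(\<And>i. i \<in> I \<Longrightarrow> f i \<in> K) \<Longrightarrow> sum f I \<in> K"
  by (induction I rule: infinite_finite_induct) auto

lemma of_nat_mem [intro]: "of_nat k \<in> K"
  by (induction k) auto

lemma of_int_mem [intro]: "of_int k \<in> K"
  by (cases k) auto

lemma Rats_subset: "\<rat> \<subseteq> K"
proof
  fix q :: complex assume "q \<in> \<rat>"
  then obtain a b where "q = of_int a / of_int b" by (auto elim: Rats_cases')
  thus "q \<in> K" by auto
qed

lemma mult_mem_cancel: "a \<in> K \<Longrightarrow> a \<noteq> 0 \<Longrightarrow> b * a \<in> K \<Longrightarrow> b \<in> K"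
  using divide_mem[of "b * a" a] by auto

text \<open>\<open>[b, 1]\<close> is independent because \<open>b\<close> lies outside
  \<open>K\<close>, the span of 1; two independent vectors fill a space of dimension 2.\<close>

lemma two_dim_eq:
  assumes "ring.dimension CC 2 K E" "1 \<in> E" "b \<in> E" "b \<notin> K"
  shows "E = {u + v * b | u v. u \<in> K \<and> v \<in> K}"
proof -
  interpret field CC by (rule field_CC)
  have S: "Span K [1] = K"
    using line_extension_mem_iff[of _ K 1 "{0}"] by auto
  have "independent K [b, 1]"
  proof (intro li_Cons)
    show "b \<notin> Span K [1]" unfolding S by (rule assms(4))
  qed auto
  from independent_length_eq_dimension[OF subfield assms(1) this]
  have "E = Span K [b, 1]" using assms(2,3) by (simp del: Span.simps)
  also have "\<dots> = line_extension K b (Span K [1])" by (simp only: Span.simps foldr.simps o_apply)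
  also have "\<dots> = line_extension K b K" unfolding S ..
  finally have E: "E = line_extension K b K" .
  show ?thesis
  proof (rule Set.set_eqI)
    fix y
    have "y \<in> E \<longleftrightarrow> (\<exists>k\<in>K. \<exists>v\<in>K. y = v + k * b)"
      unfolding E line_extension_mem_iff CC_simps by (simp only: add.commute)
    thus "y \<in> E \<longleftrightarrow> y \<in> {u + v * b | u v. u \<in> K \<and> v \<in> K}" by blast
  qed
qed

lemma one_dim_eq:
  assumes "ring.dimension CC 1 K E" "1 \<in> E"
  shows "E = K"
proof -
  interpret field CC by (rule field_CC)
  have S: "Span K [1] = K"
    using line_extension_mem_iff[of _ K 1 "{0}"] by auto
  have "independent K [1]" by (intro li_Cons) auto
  from independent_length_eq_dimension[OF subfield assms(1) this]
  have "Span K [1] = E" using assms(2) by (simp del: Span.simps)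
  thus ?thesis unfolding S ..
qed

lemma adjoin_mem: "a \<in> adjoin K a" and subset_adjoin: "K \<subseteq> adjoin K a"
  unfolding adjoin_def by (auto intro: generate_field.incl)

lemma adjoin_eq_iff: "adjoin K a = K \<longleftrightarrow> a \<in> K"
proof
  assume "a \<in> K"
  thus "adjoin K a = K"
    using field.generate_field_min_subfield1[OF field_CC _ subfield, of "insert a K"] subset_adjoin[of a]
    by (auto simp: adjoin_def)
qed (use adjoin_mem[of a] in simp)

text \<open>The minimal polynomial divides \<open>X - a\<close>, so it is linear and has only one
  root. This covers a \<open>\<gamma>\<^sub>1\<close> in \<open>K\<close> when
  \<open>\<beta>\<^sub>1\<close> is quadratic.\<close>

lemma conjugate_self:
  assumes "a \<in> K" "is_the_conjugate K a b"
  shows "b = a"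
proof -
  interpret domain CC by (rule domain_CC)
  have p: "[1, - a] \<in> carrier (K [X]\<^bsub>CC\<^esub>)"
    using assms(1) by (auto simp: univ_poly_def polynomial_def)
  have ev: "eval [1, - a] a = 0" by simp
  have alg: "(algebraic over K) a" by (rule algebraicI[OF p _]) auto
  note Irr = IrrE[OF subfield _ alg, simplified]
  have "degree (Irr K a) \<le> degree [1, - a]"
    by (rule pdivides_imp_degree_le[OF subfieldE(1)[OF subfield] Irr(1) p _
          Irr_minimal[OF subfield _ alg p ev[folded CC_simps(4)]]]) auto
  moreover have "degree (Irr K a) \<ge> 1"
    by (rule pirreducible_degree[OF subfield Irr(1,2)])
  ultimately obtain c c' where "Irr K a = [c, c']"
    by (cases "Irr K a" rule: remdups_adj.cases) auto
  hence "Irr K a = [1, c']" using Irr(3) by simp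
  thus ?thesis
    using Irr(4) assms(2) by (auto simp: is_the_conjugate_def conjugates_over_def eq_neg_iff_add_eq_0
       set_eq_iff) (metis add_right_cancel)
qed

text \<open>The minimal polynomial divides the given quadratic, and degree 1 would put
  \<open>a\<close> into \<open>K\<close>. It is therefore itself quadratic with roots
  \<open>a\<close> and \<open>b\<close>, and Vieta's formulas apply.\<close>

lemma conjugate_quadratic:
  assumes a: "a \<notin> K" "a\<^sup>2 + p * a + q = 0" "p \<in> K" "q \<in> K" and b: "is_the_conjugate K a b"
  shows "a + b \<in> K \<and> a * b \<in> K"
proof -
  interpret domain CC by (rule domain_CC)
  have f: "[1, p, q] \<in> carrier (K [X]\<^bsub>CC\<^esub>)"
    using a by (auto simp: univ_poly_def polynomial_def)
  have ev: "eval [1, p, q] a = 0" using a(2) by (simp add: add.assoc power2_eq_square)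
  have alg: "(algebraic over K) a" by (rule algebraicI[OF f _]) (use ev in auto)
  note Irr = IrrE[OF subfield _ alg, simplified]
  have "degree (Irr K a) \<le> degree [1, p, q]"
    by (rule pdivides_imp_degree_le[OF subfieldE(1)[OF subfield] Irr(1) f _
          Irr_minimal[OF subfield _ alg f ev[folded CC_simps(4)]]]) auto
  moreover have "degree (Irr K a) \<ge> 1"
    by (rule pirreducible_degree[OF subfield Irr(1,2)])
  moreover have "set (Irr K a) \<subseteq> K"
    using Irr(1) by (auto simp: univ_poly_def polynomial_def)
  ultimately consider c where "Irr K a = [1, c]" "c \<in> K" | c d where "Irr K a = [1, c, d]" "c \<in> K" "d \<in> K"
    using Irr(3) by (cases "Irr K a"; cases "tl (Irr K a)"; cases "tl (tl (Irr K a))") auto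
  thus ?thesis
  proof cases
    case 1
    hence "a = - c" using Irr(4) by (simp add: eq_neg_iff_add_eq_0)
    thus ?thesis using 1 a(1) by auto
  next
    case 2
    have roots: "y\<^sup>2 + c * y + d = 0 \<longleftrightarrow> y = a \<or> y = b" for y
    proof -
      have "y \<in> {y. eval (Irr K a) y = 0} \<longleftrightarrow> y \<in> {a, b}"
        using b unfolding is_the_conjugate_def conjugates_over_def by (rule arg_cong)
      moreover have "eval [1, c, d] y = y\<^sup>2 + c * y + d"
        by (simp add: power2_eq_square add.assoc)
      ultimately show ?thesis unfolding 2(1) by (simp add: add.assoc)
    qed
    have ra: "a\<^sup>2 + c * a + d = 0" by (rule roots[THEN iffD2]) simp
    have "(- c - a)\<^sup>2 + c * (- c - a) + d = a\<^sup>2 + c * a + d"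
      by (simp add: power2_eq_square algebra_simps)
    hence "- c - a = a \<or> - c - a = b" unfolding ra by (rule roots[THEN iffD1])
    \<comment> \<open>No double root: otherwise \<open>2 * a\<close> would be in \<open>K\<close>,
      and division by 2 is possible.\<close>
    moreover have "- c - a \<noteq> a"
    proof
      assume "- c - a = a"
      moreover have "a * 2 = a - (- c - a) - c" by simp
      ultimately have "a * 2 = - c" by simp
      hence "a * 2 \<in> K" using 2 by auto
      thus False using mult_mem_cancel[of 2 a] of_nat_mem[of 2] a(1) by auto
    qed
    ultimately have b: "b = - c - a" by simp
    hence "a + b \<in> K" using 2 by auto
    moreover have "a * b = d"
    proof -
      have "a * b = d - (a\<^sup>2 + c * a + d)" unfolding b by (simp add: power2_eq_square algebra_simps)
      thus ?thesis unfolding ra by simp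
    qed
    ultimately show ?thesis using 2 by simp
  qed
qed

end

section \<open>Integers of an imaginary quadratic field\<close>

lemma complex_subfield_Rats: "complex_subfield \<rat>"
  by (intro complex_subfield.intro subfield_CCI) auto

lemma cnj_Rats: "q \<in> \<rat> \<Longrightarrow> cnj q = q"
  by (auto elim!: Rats_cases')

text \<open>A nonreal \<open>z\<close> is conjugate to \<open>cnj z\<close> over the rationals, so \<open>z * cnj z\<close> is a rational integer.\<close>

lemma imaginary_quadratic_field_norm_ge_1:
  assumes K: "imaginary_quadratic_field K" and z: "z \<in> K" "algebraic_int z" "z \<noteq> 0"
  shows "cmod z \<ge> 1"
proof -
  have sub: "complex_subfield K"
    using K by (simp add: imaginary_quadratic_field_def complex_subfield_def)
  have dim: "ring.dimension CC 2 \<rat> K" and nr: "\<not> K \<subseteq> \<real>"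
    using K by (auto simp: imaginary_quadratic_field_def)
  have int_ge_1: "cmod y \<ge> 1" if "y \<in> \<rat>" "algebraic_int y" "y \<noteq> 0" for y
  proof -
    have "y \<in> \<int>" using that rational_algebraic_int_is_int by blast
    then obtain k where "y = of_int k" by (auto elim: Ints_cases)
    thus ?thesis using that(3) by simp
  qed
  show ?thesis
  proof (cases "z \<in> \<rat>")
    case True
    thus ?thesis using int_ge_1 z by blast
  next
    case False
    hence span: "K = {u + v * z | u v. u \<in> \<rat> \<and> v \<in> \<rat>}"
      using complex_subfield.two_dim_eq[OF complex_subfield_Rats dim complex_subfield.one_mem[OF sub] z(1)]
      by simp
    have "z \<notin> \<real>"
    proof
      assume "z \<in> \<real>"
      hence "K \<subseteq> \<real>" unfolding span by (auto simp: Reals_cnj_iff cnj_Rats)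
      thus False using nr by simp
    qed
    hence neq: "z \<noteq> cnj z" by (metis Reals_cnj_iff)
    have "z * z \<in> K" by (rule complex_subfield.mult_mem[OF sub z(1) z(1)])
    then obtain u v where uv: "u \<in> \<rat>" "v \<in> \<rat>" "z * z = u + v * z"
      unfolding span by blast
    have cnj: "cnj u = u" "cnj v = v" using uv(1,2) by (auto simp: cnj_Rats)
    \<comment> \<open>\<open>z\<close> and \<open>cnj z\<close> satisfy the same rational quadratic
      equation; its coefficients must be their sum and, up to sign, their product.\<close>
    have "cnj z * cnj z = u + v * cnj z"
      using arg_cong[OF uv(3), of cnj] by (simp add: cnj)
    moreover have "(z - cnj z) * (z + cnj z - v) = (z * z - v * z) - (cnj z * cnj z - v * cnj z)"
      by (simp only: ring_distribs) (simp only: algebra_simps)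
    ultimately have "(z - cnj z) * (z + cnj z - v) = 0"
      unfolding uv(3) by simp
    moreover have "z - cnj z \<noteq> 0" using neq by simp
    ultimately have v: "v = z + cnj z" by (simp only: mult_eq_0_iff right_minus_eq) simp
    have "z * cnj z = v * z - z * z" unfolding v by (simp only: ring_distribs mult.commute) simp
    also have "\<dots> = - u" unfolding uv(3) by simp
    finally have "z * cnj z = - u" .
    hence "z * cnj z \<in> \<rat>" using uv(1) by simp
    hence "cmod (z * cnj z) \<ge> 1" using z by (intro int_ge_1) auto
    hence "1\<^sup>2 \<le> (cmod z)\<^sup>2" by (simp add: norm_mult power2_eq_square)
    thus ?thesis by (rule power2_le_imp_le) simp
  qed
qed

section \<open>The automorphism of a quadratic extension\<close>

locale quadratic_extension = complex_subfield +
  fixes s :: complex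
  assumes s: "s \<notin> K" "s\<^sup>2 \<in> K"
begin

text \<open>\<open>conj_pair\<close> is the graph of the nontrivial automorphism of \<open>K(s)\<close> over \<open>K\<close>.\<close>

definition conj_pair :: "complex \<Rightarrow> complex \<Rightarrow> bool" where
  "conj_pair y y' \<longleftrightarrow> (\<exists>u\<in>K. \<exists>v\<in>K. y = u + v * s \<and> y' = u - v * s)"

lemma conj_pair_const: "y \<in> K \<Longrightarrow> conj_pair y y"
  unfolding conj_pair_def by (intro bexI[of _ y] bexI[of _ 0]) auto

lemma conj_pair_add: "conj_pair a a' \<Longrightarrow> conj_pair b b' \<Longrightarrow> conj_pair (a + b) (a' + b')"
  unfolding conj_pair_def
proof safe
  fix u v u' v' assume "u \<in> K" "v \<in> K" "u' \<in> K" "v' \<in> K"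
  thus "\<exists>u''\<in>K. \<exists>v''\<in>K. u + v * s + (u' + v' * s) = u'' + v'' * s \<and>
          u - v * s + (u' - v' * s) = u'' - v'' * s"
    by (intro bexI[of _ "u + u'"] bexI[of _ "v + v'"]) (auto simp: algebra_simps)
qed

lemma conj_pair_mult:
  assumes "conj_pair a a'" "conj_pair b b'"
  shows "conj_pair (a * b) (a' * b')"
proof -
  obtain u v where uv: "u \<in> K" "v \<in> K" "a = u + v * s" "a' = u - v * s"
    using assms(1) unfolding conj_pair_def by blast
  obtain u' v' where uv': "u' \<in> K" "v' \<in> K" "b = u' + v' * s" "b' = u' - v' * s"
    using assms(2) unfolding conj_pair_def by blast
  have "a * b = (u * u' + v * v' * s\<^sup>2) + (u * v' + v * u') * s"
    unfolding uv(3) uv'(3) by (simp add: power2_eq_square algebra_simps)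
  moreover have "a' * b' = (u * u' + v * v' * s\<^sup>2) - (u * v' + v * u') * s"
    unfolding uv(4) uv'(4) by (simp add: power2_eq_square algebra_simps)
  moreover have "u * u' + v * v' * s\<^sup>2 \<in> K" "u * v' + v * u' \<in> K"
    by (intro add_mem mult_mem uv uv' s(2))+
  ultimately show ?thesis unfolding conj_pair_def by blast
qed

lemma conj_pair_minus: "conj_pair a a' \<Longrightarrow> conj_pair (- a) (- a')"
  using conj_pair_mult[OF conj_pair_const[of "-1"], of a a'] by auto

lemma conj_pair_diff: "conj_pair a a' \<Longrightarrow> conj_pair b b' \<Longrightarrow> conj_pair (a - b) (a' - b')"
  using conj_pair_add[OF _ conj_pair_minus, of a a' b b'] by simp

lemma conj_pair_power: "conj_pair a a' \<Longrightarrow> conj_pair (a ^ k) (a' ^ k)"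
  by (induction k) (auto intro: conj_pair_const conj_pair_mult)

lemma conj_pair_sum:
  "(\<And>i. i \<in> I \<Longrightarrow> conj_pair (f i) (f' i)) \<Longrightarrow> conj_pair (sum f I) (sum f' I)"
  by (induction I rule: infinite_finite_induct) (auto intro: conj_pair_const conj_pair_add)

lemma conj_pair_sym: "conj_pair a b \<Longrightarrow> conj_pair b a"
  unfolding conj_pair_def
proof safe
  fix u v assume "u \<in> K" "v \<in> K"
  thus "\<exists>u'\<in>K. \<exists>v'\<in>K. u - v * s = u' + v' * s \<and> u + v * s = u' - v' * s"
    by (intro bexI[of _ u] bexI[of _ "- v"]) auto
qed

lemma conj_pair_self_mem: "conj_pair y y \<Longrightarrow> y \<in> K"
proof -
  assume "conj_pair y y"
  then obtain u v where uv: "u \<in> K" "v \<in> K" "y = u + v * s" "y = u - v * s"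
    unfolding conj_pair_def by blast
  have "2 * y = (u + v * s) + (u - v * s)" unfolding uv(3,4)[symmetric] by simp
  thus "y \<in> K" using uv(1) by simp
qed

text \<open>Elements negated by the automorphism are the multiples \<open>v * s\<close> with
  \<open>v\<close> in \<open>K\<close>, and \<open>s\<^sup>2\<close> is in \<open>K\<close>.\<close>

lemma conj_pair_neg_mem:
  assumes "conj_pair y (- y)"
  shows "s * y \<in> K"
proof -
  obtain u v where uv: "u \<in> K" "v \<in> K" "y = u + v * s" "- y = u - v * s"
    using assms unfolding conj_pair_def by blast
  have "2 * u = (u + v * s) + (u - v * s)" by simp
  also have "\<dots> = 0" unfolding uv(3,4)[symmetric] by simp
  finally have "s * y = v * s\<^sup>2" unfolding uv(3) by (simp add: power2_eq_square)
  thus ?thesis using mult_mem[OF uv(2) s(2)] by simp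
qed

text \<open>The coordinates of 0 are unique because \<open>s\<close> is not in \<open>K\<close>.
  With compatibility with sums and products, this allows polynomial equations to be
  conjugated.\<close>

lemma conj_pair_0: "conj_pair 0 y \<Longrightarrow> y = 0"
proof -
  assume "conj_pair 0 y"
  then obtain u v where uv: "u \<in> K" "v \<in> K" "0 = u + v * s" "y = u - v * s"
    unfolding conj_pair_def by blast
  have "v = 0"
  proof (rule ccontr)
    assume "v \<noteq> 0"
    moreover have "s * v = - u"
    proof -
      have "s * v = (u + v * s) - u" by simp
      thus ?thesis unfolding uv(3)[symmetric] by simp
    qed
    hence "s * v \<in> K" using minus_mem[OF uv(1)] by simp
    ultimately show False using mult_mem_cancel[OF uv(2)] s(1) by blast
  qed
  thus "y = 0" using uv by simp
qed

text \<open>Links the conjugate defined by the minimal polynomial to the automorphism. Both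
  \<open>y'\<close> and \<open>u - v * s\<close> have sum and product with \<open>y\<close> in
  \<open>K\<close>; hence their difference \<open>e\<close> and also \<open>y * e\<close> lie in
  \<open>K\<close>, which forces \<open>e = 0\<close> when \<open>y\<close> does not.\<close>

lemma conj_pairI:
  assumes y: "y = u + v * s" "u \<in> K" "v \<in> K" and c: "is_the_conjugate K y y'"
  shows "conj_pair y y'"
proof (cases "y \<in> K")
  case True
  thus ?thesis using conjugate_self[OF True c] conj_pair_const by simp
next
  case False
  have "y\<^sup>2 + (- 2 * u) * y + (u\<^sup>2 - v\<^sup>2 * s\<^sup>2) = 0"
    by (simp add: y(1) power2_eq_square algebra_simps)
  moreover have "- 2 * u \<in> K" "u\<^sup>2 - v\<^sup>2 * s\<^sup>2 \<in> K"
    using mult_mem[OF of_int_mem[of "- 2"] y(2)]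
      diff_mem[OF power_mem[OF y(2)] mult_mem[OF power_mem[OF y(3)] s(2)]] by simp_all
  ultimately have yy': "y + y' \<in> K" "y * y' \<in> K"
    using conjugate_quadratic[OF False _ _ _ c] by blast+
  define e where "e = y' - (u - v * s)"
  have "e = (y + y') + (- 2 * u)" unfolding e_def y(1) by (simp add: algebra_simps)
  hence e: "e \<in> K" using add_mem[OF yy'(1) \<open>- 2 * u \<in> K\<close>] by simp
  have "y * e = y * y' - (u\<^sup>2 - v\<^sup>2 * s\<^sup>2)"
    unfolding e_def y(1) by (simp add: power2_eq_square algebra_simps)
  hence "y * e \<in> K" using diff_mem[OF yy'(2) \<open>u\<^sup>2 - v\<^sup>2 * s\<^sup>2 \<in> K\<close>] by simp
  hence "e = 0" using mult_mem_cancel[OF e] False by blast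
  hence "y' = u - v * s" by (simp add: e_def)
  thus ?thesis using y unfolding conj_pair_def by blast
qed

text \<open>Integer coefficients are fixed by the automorphism, so \<open>b\<close> is a root of the
  same monic polynomial as \<open>a\<close>.\<close>

lemma conj_pair_algebraic_int:
  assumes "conj_pair a b" "algebraic_int a"
  shows "algebraic_int b"
proof -
  obtain p where p: "poly (map_poly of_int p) a = 0" "Polynomial.lead_coeff p = 1"
    using assms(2) by (auto simp: algebraic_int_altdef_ipoly)
  have "conj_pair (poly (map_poly of_int p) a) (poly (map_poly of_int p) b)"
    unfolding poly_altdef
    by (intro conj_pair_sum conj_pair_mult conj_pair_power assms(1) conj_pair_const)
       (auto simp: coeff_map_poly)
  hence "poly (map_poly of_int p) b = 0" using p(1) conj_pair_0 by simp
  thus ?thesis using p(2) by (auto simp: algebraic_int_altdef_ipoly)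
qed

end

section \<open>Arithmetic of the approximants\<close>

lemma pade_form_minus: "pade_form s r (- z) (- u) = (- 1) ^ r * pade_form s r z u"
proof -
  have "(- z) ^ k * (- u) ^ (r - k) = (- 1) ^ r * (z ^ k * u ^ (r - k))" if "k \<le> r" for k
  proof -
    have "(-1 :: complex) ^ r = (-1) ^ k * (-1) ^ (r - k)" using that by (simp flip: power_add)
    thus ?thesis by (simp add: power_minus[of z] power_minus[of u] mult_ac)
  qed
  thus ?thesis unfolding pade_form_def sum_distrib_left
    by (intro sum.cong refl) (simp add: mult_ac)
qed

lemma (in complex_subfield) pade_form_mem:
  assumes "\<And>k. k \<le> r \<Longrightarrow> of_real (pade_coeff s r k) \<in> K" "z \<in> K" "u \<in> K"
  shows "pade_form s r z u \<in> K"
  unfolding pade_form_def by (intro sum_mem mult_mem power_mem assms) auto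

lemma (in quadratic_extension) conj_pair_pade_form:
  assumes "\<And>k. k \<le> r \<Longrightarrow> of_real (pade_coeff \<sigma> r k) \<in> K" "conj_pair z z'" "conj_pair u u'"
  shows "conj_pair (pade_form \<sigma> r z u) (pade_form \<sigma> r z' u')"
  unfolding pade_form_def
  by (intro conj_pair_sum conj_pair_mult conj_pair_power conj_pair_const assms) auto

text \<open>Numerator of the expression for \<open>A\<close> at \<open>a / b\<close>, cleared of
  \<open>b\<close>; no division by a possibly vanishing \<open>b\<close> occurs.\<close>

definition approx_num :: "complex \<Rightarrow> complex \<Rightarrow> complex \<Rightarrow> complex \<Rightarrow> complex \<Rightarrow> complex" where
  "approx_num \<beta>\<^sub>1 \<beta>\<^sub>2 x a b = \<beta>\<^sub>1 * (x - \<beta>\<^sub>2) * a - \<beta>\<^sub>2 * (x - \<beta>\<^sub>1) * b"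

definition approx_den :: "complex \<Rightarrow> complex \<Rightarrow> complex \<Rightarrow> complex \<Rightarrow> complex \<Rightarrow> complex" where
  "approx_den \<beta>\<^sub>1 \<beta>\<^sub>2 x a b = (x - \<beta>\<^sub>2) * a - (x - \<beta>\<^sub>1) * b"

context quadratic_extension
begin

text \<open>Conjugation over \<open>K\<close> sends \<open>Z\<close> to \<open>- U\<close>, hence multiplies the approximants by
  \<open>(- 1) ^ (r + 1)\<close>: they lie in \<open>K\<close> for odd \<open>r\<close> and in \<open>s * K\<close> for even \<open>r\<close>.\<close>

lemma approximants_mem:
  assumes \<beta>: "conj_pair \<beta>\<^sub>1 \<beta>\<^sub>2" and x: "x \<in> K" and ZU: "conj_pair Z (- U)"
    and coeff: "\<And>k. k \<le> r \<Longrightarrow> of_real (pade_coeff \<sigma> r k) \<in> K"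
  defines "a \<equiv> pade_form \<sigma> r Z U" and "b \<equiv> pade_form \<sigma> r U Z"
  shows "(if even r then s else 1) * approx_num \<beta>\<^sub>1 \<beta>\<^sub>2 x a b \<in> K \<and>
         (if even r then s else 1) * approx_den \<beta>\<^sub>1 \<beta>\<^sub>2 x a b \<in> K"
proof -
  have UZ: "conj_pair U (- Z)" using conj_pair_minus[OF conj_pair_sym[OF ZU]] by simp
  have a: "conj_pair a ((-1) ^ r * b)"
    unfolding a_def b_def pade_form_minus[symmetric] by (rule conj_pair_pade_form[OF coeff ZU UZ])
  have b: "conj_pair b ((-1) ^ r * a)"
    unfolding a_def b_def pade_form_minus[symmetric] by (rule conj_pair_pade_form[OF coeff UZ ZU])
  have \<beta>': "conj_pair \<beta>\<^sub>2 \<beta>\<^sub>1" by (rule conj_pair_sym[OF \<beta>])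
  note xs = conj_pair_const[OF x]
  have "conj_pair (approx_num \<beta>\<^sub>1 \<beta>\<^sub>2 x a b)
         (\<beta>\<^sub>2 * (x - \<beta>\<^sub>1) * ((-1) ^ r * b) - \<beta>\<^sub>1 * (x - \<beta>\<^sub>2) * ((-1) ^ r * a))"
    unfolding approx_num_def by (intro conj_pair_diff conj_pair_mult \<beta> \<beta>' a b xs)
  also have "\<beta>\<^sub>2 * (x - \<beta>\<^sub>1) * ((-1) ^ r * b) - \<beta>\<^sub>1 * (x - \<beta>\<^sub>2) * ((-1) ^ r * a) =
     - ((-1) ^ r * approx_num \<beta>\<^sub>1 \<beta>\<^sub>2 x a b)"
    by (simp add: approx_num_def right_diff_distrib mult_ac)
  finally have num: "conj_pair (approx_num \<beta>\<^sub>1 \<beta>\<^sub>2 x a b) (- ((-1) ^ r * approx_num \<beta>\<^sub>1 \<beta>\<^sub>2 x a b))" .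
  have "conj_pair (approx_den \<beta>\<^sub>1 \<beta>\<^sub>2 x a b)
         ((x - \<beta>\<^sub>1) * ((-1) ^ r * b) - (x - \<beta>\<^sub>2) * ((-1) ^ r * a))"
    unfolding approx_den_def by (intro conj_pair_diff conj_pair_mult \<beta> \<beta>' a b xs)
  also have "(x - \<beta>\<^sub>1) * ((-1) ^ r * b) - (x - \<beta>\<^sub>2) * ((-1) ^ r * a) =
     - ((-1) ^ r * approx_den \<beta>\<^sub>1 \<beta>\<^sub>2 x a b)"
    by (simp add: approx_den_def algebra_simps)
  finally have den: "conj_pair (approx_den \<beta>\<^sub>1 \<beta>\<^sub>2 x a b) (- ((-1) ^ r * approx_den \<beta>\<^sub>1 \<beta>\<^sub>2 x a b))" .
  show ?thesis
  proof (cases "even r")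
    case True
    thus ?thesis using conj_pair_neg_mem num den by simp
  next
    case False
    thus ?thesis using conj_pair_self_mem num den by simp
  qed
qed

end

section \<open>Denominators and common factors of the hypergeometric polynomials\<close>

lemma of_rat_pochhammer: "of_rat (pochhammer a k) = pochhammer (of_rat a :: 'a :: field_char_0) k"
  by (induction k) (simp_all add: pochhammer_Suc of_rat_mult of_rat_add)

text \<open>Both upper Pochhammer symbols contribute \<open>(-1) ^ k\<close>; the first also gives
  \<open>fact k\<close> times a binomial coefficient, the second is read backwards as a rising
  factorial.\<close>

lemma of_rat_coeff_X_poly:
  assumes n: "n \<ge> 2"
  shows "of_rat (poly.coeff (X_poly n r) k) = (if k \<le> r then pade_coeff (1 / real n) r k else 0)"
proof -
  have coeff: "poly.coeff (X_poly n r) k = (if k \<le> r then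
     pochhammer (- of_nat r) k * pochhammer (- of_nat r - 1 / of_nat n) k /
      (pochhammer (1 - 1 / of_nat n) k * fact k) else 0)"
    by (simp add: X_poly_def coeff_sum coeff_monom if_distrib cong: if_cong)
  show ?thesis
  proof (cases "k \<le> r")
    case True
    define s where "s = 1 / real n"
    have 1: "pochhammer (- real r) k = (-1) ^ k * fact k * real (r choose k)"
    proof -
      have "(-1) ^ k * pochhammer (- real r) k = fact k * real (r choose k)"
        by (simp add: binomial_gbinomial gbinomial_pochhammer)
      moreover have "pochhammer (- real r) k = (-1) ^ k * ((-1) ^ k * pochhammer (- real r) k)"
        by (simp flip: mult.assoc power_mult_distrib)
      ultimately show ?thesis by (metis mult.assoc)
    qed
    have 2: "pochhammer (- real r - s) k = (-1) ^ k * pochhammer (s + real (r - k) + 1) k"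
    proof -
      have e: "- (real r + s) = - real r - s" "real r + s - real k + 1 = s + real (r - k) + 1"
        using True by (simp_all add: of_nat_diff)
      show ?thesis by (rule pochhammer_minus[of "real r + s" k, unfolded e])
    qed
    have "of_rat (poly.coeff (X_poly n r) k) = pochhammer (- real r) k * pochhammer (- real r - s) k /
      (pochhammer (1 - s) k * fact k)"
      unfolding coeff using True of_rat_of_nat_eq[of "fact k", where 'a = real]
      by (simp add: s_def of_rat_divide of_rat_mult of_rat_pochhammer of_rat_diff of_rat_minus of_rat_inverse)
    also have "\<dots> = pade_coeff s r k"
      unfolding 1 2 pade_coeff_def by (simp add: power_mult_distrib[symmetric] field_simps)
    finally show ?thesis using True by (simp add: s_def)
  qed (simp add: coeff)
qed

lemma of_real_of_rat: "of_real (of_rat q) = (of_rat q :: complex)"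
proof -
  obtain a b where "quotient_of q = (a, b)" by force
  hence "q = of_int a / of_int b" by (rule quotient_of_div)
  thus ?thesis by (simp add: of_rat_divide)
qed

lemma pade_coeff_mem_Rats: "n \<ge> 2 \<Longrightarrow> k \<le> r \<Longrightarrow> of_real (pade_coeff (1 / real n) r k) \<in> (\<rat> :: complex set)"
  by (metis of_rat_coeff_X_poly of_real_of_rat Rats_of_rat)

definition int_poly :: "rat poly \<Rightarrow> bool" where
  "int_poly p \<longleftrightarrow> (\<forall>i. poly.coeff p i \<in> \<int>)"

lemma int_poly_mult: "int_poly p \<Longrightarrow> int_poly q \<Longrightarrow> int_poly (p * q)"
  unfolding int_poly_def coeff_mult by (auto intro: Ints_sum Ints_mult)

lemma int_poly_pcompose: "int_poly p \<Longrightarrow> int_poly q \<Longrightarrow> int_poly (pcompose p q)"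
proof (induction p)
  case (pCons a p)
  have "int_poly p" "a \<in> \<int>"
    using pCons.prems(1) unfolding int_poly_def by (metis coeff_pCons_Suc, metis coeff_pCons_0)
  moreover from this have "int_poly (q * pcompose p q)" using pCons by (intro int_poly_mult) auto
  ultimately show ?case
    unfolding pcompose_pCons by (auto simp: int_poly_def coeff_pCons split: nat.splits intro: Ints_add)
qed (simp add: int_poly_def)

text \<open>Provides the witness for the \<open>LEAST\<close> in \<open>D_denom\<close>.\<close>

lemma common_denominator:
  fixes S :: "rat set"
  assumes "finite S"
  shows "\<exists>D>0. \<forall>q\<in>S. of_nat D * q \<in> \<int>"
  using assms
proof (induction S rule: finite_induct)
  case (insert q S)
  then obtain D where D: "D > 0" "\<And>q. q \<in> S \<Longrightarrow> of_nat D * q \<in> \<int>" by blast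
  obtain a b where q: "quotient_of q = (a, b)" by force
  have b: "b > 0" and q: "q = of_int a / of_int b"
    using quotient_of_denom_pos[OF q] quotient_of_div[OF q] by auto
  have "of_nat (D * nat b) * q' \<in> \<int>" if "q' \<in> insert q S" for q'
  proof (cases "q' = q")
    case True
    have "(of_nat (D * nat b) :: rat) = of_int (int D * b)" using b by simp
    hence "of_nat (D * nat b) * q = of_int (int D * a)" using b by (simp add: q)
    thus ?thesis unfolding True by (metis Ints_of_int)
  next
    case False
    hence "of_nat D * q' \<in> \<int>" using that D(2) by blast
    hence "of_nat D * q' * of_nat (nat b) \<in> \<int>" by (rule Ints_mult[OF _ Ints_of_nat])
    thus ?thesis by (simp only: of_nat_mult mult_ac)
  qed
  thus ?case using D(1) b by (intro exI[of _ "D * nat b"]) auto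
qed (intro exI[of _ 1], simp)

lemma D_denom: "D_denom n r > 0" "int_poly (Polynomial.smult (of_nat (D_denom n r)) (X_poly n r))"
proof -
  have "finite (range (poly.coeff (X_poly n r)))" by (simp add: range_coeff)
  from common_denominator[OF this] obtain D :: nat
    where "D > 0" "\<forall>q\<in>range (poly.coeff (X_poly n r)). of_nat D * q \<in> \<int>"
    by (elim exE conjE)
  hence "D > 0 \<and> (\<forall>i. of_nat D * poly.coeff (X_poly n r) i \<in> \<int>)" by simp
  hence "D_denom n r > 0 \<and> (\<forall>i. of_nat (D_denom n r) * poly.coeff (X_poly n r) i \<in> \<int>)"
    unfolding D_denom_def by (rule LeastI)
  thus "D_denom n r > 0" "int_poly (Polynomial.smult (of_nat (D_denom n r)) (X_poly n r))"
    by (auto simp: int_poly_def)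
qed

lemma N_num_nonneg: "N_num d n r \<ge> 0" unfolding N_num_def by simp

text \<open>If all numerators were 0, the polynomial \<open>X_poly n r\<close> composed with
  \<open>1 - d * y\<close> would vanish; but at \<open>y = 1 / d\<close> it takes the value of
  \<open>X_poly n r\<close> at 0, which is 1.\<close>

lemma N_num_pos:
  assumes "n \<ge> 2" "d > 0"
  shows "N_num d n r > 0"
proof (rule ccontr)
  assume "\<not> N_num d n r > 0"
  hence "N_num d n r = 0" using N_num_nonneg[of d n r] by simp
  hence 0: "fst (quotient_of (poly.coeff (pcompose (X_poly n r) [:1, - of_nat d:]) i)) = 0" for i
    unfolding N_num_def by (auto simp: Gcd_0_iff)
  have "poly.coeff (pcompose (X_poly n r) [:1, - of_nat d:]) i = 0" for i
    using 0[of i] quotient_of_div[of "poly.coeff (pcompose (X_poly n r) [:1, - of_nat d:]) i"]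
    by (cases "quotient_of (poly.coeff (pcompose (X_poly n r) [:1, - of_nat d:]) i)") auto
  hence "pcompose (X_poly n r) [:1, - of_nat d:] = 0" by (simp add: poly_eq_iff)
  hence "poly (X_poly n r) (poly [:1, - of_nat d:] (1 / of_nat d)) = 0"
    by (metis poly_pcompose poly_0)
  hence "poly.coeff (X_poly n r) 0 = 0" using assms by (simp add: poly_0_coeff_0)
  moreover have "of_rat (poly.coeff (X_poly n r) 0) = (1::real)"
    using of_rat_coeff_X_poly[OF assms(1), of r 0] by (simp add: pade_coeff_def)
  ultimately show False by simp
qed

text \<open>For a coefficient \<open>a / b\<close> in lowest terms, \<open>N\<close> divides
  \<open>a\<close> by its definition, and \<open>b\<close> divides \<open>D\<close> because the
  integral substitution \<open>1 - d * y\<close> preserves integrality. Thus the product is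
  \<open>(D / b) * (a / N)\<close>.\<close>

lemma D_div_N_int_poly:
  assumes "n \<ge> 2" "d > 0"
  shows "of_nat (D_denom n r) / of_int (N_num d n r) *
           poly.coeff (pcompose (X_poly n r) [:1, - of_nat d:]) i \<in> \<int>"
proof -
  define N where "N = N_num d n r"
  define D where "D = D_denom n r"
  define c where "c = poly.coeff (pcompose (X_poly n r) [:1, - of_nat d:]) i"
  have N: "N > 0" unfolding N_def by (rule N_num_pos[OF assms])
  obtain a b where ab: "quotient_of c = (a, b)" by force
  have b: "b > 0" and cop: "coprime a b" and c: "c = of_int a / of_int b"
    using quotient_of_denom_pos[OF ab] quotient_of_coprime[OF ab] quotient_of_div[OF ab] by auto
  have "N dvd a"
  proof -
    have "N dvd fst (quotient_of c)" unfolding N_def N_num_def c_def by (intro Gcd_dvd) simp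
    thus ?thesis by (simp add: ab)
  qed
  then obtain k where k: "a = N * k" by blast
  have "int_poly [:1, - of_nat d:]" by (auto simp: int_poly_def coeff_pCons split: nat.splits)
  hence "int_poly (pcompose (Polynomial.smult (of_nat D) (X_poly n r)) [:1, - of_nat d:])"
    unfolding D_def by (intro int_poly_pcompose D_denom(2))
  hence "of_nat D * c \<in> \<int>" by (simp add: int_poly_def pcompose_smult c_def)
  then obtain m where "of_nat D * c = of_int m" by (auto elim: Ints_cases)
  hence "(of_int (int D * a) :: rat) = of_int (m * b)" using b by (simp add: c field_simps)
  hence "int D * a = m * b" by (simp only: of_int_eq_iff)
  hence "b dvd int D * a" by simp
  hence "b dvd int D" using cop by (simp add: coprime_commute coprime_dvd_mult_left_iff)
  then obtain l where l: "int D = b * l" by blast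
  have "of_nat D = (of_int (int D) :: rat)" by simp
  hence "of_nat D / of_int N * c = (of_int (b * l) / of_int N * (of_int (N * k) / of_int b) :: rat)"
    unfolding c k l by simp
  also have "\<dots> = of_int (l * k)" using N b by (simp add: field_simps)
  finally show ?thesis by (simp add: D_def N_def c_def)
qed

lemma degree_X_poly_le: "Polynomial.degree (X_poly n r) \<le> r"
  unfolding X_poly_def by (intro degree_sum_le order_trans[OF degree_monom_le]) auto

lemma poly_map_of_rat:
  assumes "Polynomial.degree p \<le> m"
  shows "poly (map_poly of_rat p) z = (\<Sum>k\<le>m. of_rat (poly.coeff p k) * (z :: complex) ^ k)"
proof -
  have "Polynomial.degree (map_poly of_rat p :: complex poly) \<le> m"
    using assms by (simp add: degree_map_poly)
  from poly_as_sum_of_monoms'[OF this]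
  have "poly (map_poly of_rat p) z =
      poly (\<Sum>k\<le>m. Polynomial.monom (poly.coeff (map_poly of_rat p) k) k) z" by simp
  thus ?thesis by (simp add: poly_sum poly_monom coeff_map_poly)
qed

lemma pade_X_conv_X_poly:
  assumes "n \<ge> 2"
  shows "pade_X (1 / real n) r z = poly (map_poly of_rat (X_poly n r)) z"
  unfolding poly_map_of_rat[OF degree_X_poly_le] pade_X_def
proof (intro sum.cong refl)
  fix k assume "k \<in> {..r}"
  hence "pade_coeff (1 / real n) r k = of_rat (poly.coeff (X_poly n r) k)"
    using of_rat_coeff_X_poly[OF assms, of r k] by simp
  thus "of_real (pade_coeff (1 / real n) r k) * z ^ k = of_rat (poly.coeff (X_poly n r) k) * z ^ k"
    by (simp only: of_real_of_rat)
qed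

text \<open>Since \<open>z / u = 1 - d * y\<close> with \<open>y = (u - z) / (d * u)\<close>, the polynomial \<open>X(1 - d * y)\<close>
  from the definition of \<open>N_num\<close> appears.\<close>

lemma algebraic_int_pade_form:
  assumes n: "n \<ge> 2" and d: "d > 0" and nz: "u \<noteq> 0" "g \<noteq> 0"
    and ints: "algebraic_int (u / g)" "algebraic_int ((u - z) / (of_nat d * g))"
  shows "algebraic_int (of_nat (D_denom n r) / of_int (N_num d n r) *
           (pade_form (1 / real n) r z u / g ^ r))"
proof -
  define p where "p = pcompose (X_poly n r) [:1, - of_nat d:]"
  define DN where "DN = (of_nat (D_denom n r) / of_int (N_num d n r) :: rat)"
  define y where "y = (u - z) / (of_nat d * u)"
  have y: "z / u = 1 - of_nat d * y" using d nz by (simp add: y_def field_simps)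
  have "pade_X (1 / real n) r (z / u) = poly (pcompose (map_poly of_rat (X_poly n r)) [:1, - of_nat d:]) y"
    unfolding pade_X_conv_X_poly[OF n] by (simp add: poly_pcompose y mult.commute)
  also have "pcompose (map_poly of_rat (X_poly n r)) [:1, - of_nat d:] = (map_poly of_rat p :: complex poly)"
  proof -
    have "map_poly of_rat [:1, - of_nat d:] = [:1, - of_nat d :: complex:]"
      by (auto simp: poly_eq_iff coeff_map_poly coeff_pCons of_rat_minus split: nat.splits)
    thus ?thesis unfolding p_def of_rat_hom.map_poly_pcompose by simp
  qed
  finally have X: "pade_X (1 / real n) r (z / u) = poly (map_poly of_rat p) y" .
  have "Polynomial.degree p \<le> Polynomial.degree (X_poly n r) * 1"
    unfolding p_def by (rule order_trans[OF degree_pcompose_le]) (intro mult_left_mono, auto)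
  hence "Polynomial.degree p \<le> r" using degree_X_poly_le[of n r] by linarith
  from poly_map_of_rat[OF this]
  have "pade_form (1 / real n) r z u / g ^ r =
     (u / g) ^ r * (\<Sum>i\<le>r. of_rat (poly.coeff p i) * y ^ i)"
    unfolding pade_form_conv_X[OF nz(1)] X by (simp add: power_divide)
  also have "\<dots> = (\<Sum>i\<le>r. of_rat (poly.coeff p i) * (((u - z) / (of_nat d * g)) ^ i * (u / g) ^ (r - i)))"
    unfolding sum_distrib_left
  proof (intro sum.cong refl)
    \<comment> \<open>Each of the \<open>i\<close> factors \<open>y\<close> absorbs one
      \<open>u / g\<close> and becomes \<open>(u - z) / (d * g)\<close>; \<open>r - i\<close>
      factors \<open>u / g\<close> remain.\<close>
    fix i assume "i \<in> {..r}"
    hence e1: "(u / g) ^ r = (u / g) ^ i * (u / g) ^ (r - i)" by (simp flip: power_add)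
    have e2: "(u / g) ^ i * y ^ i = ((u - z) / (of_nat d * g)) ^ i"
    proof -
      have "(u / g) * y = (u - z) / (of_nat d * g)" using nz d by (simp add: y_def)
      thus ?thesis by (simp only: power_mult_distrib[symmetric])
    qed
    show "(u / g) ^ r * (of_rat (poly.coeff p i) * y ^ i) =
       of_rat (poly.coeff p i) * (((u - z) / (of_nat d * g)) ^ i * (u / g) ^ (r - i))"
      unfolding e1 e2[symmetric] by (simp only: mult_ac)
  qed
  finally have "of_nat (D_denom n r) / of_int (N_num d n r) * (pade_form (1 / real n) r z u / g ^ r) =
     (\<Sum>i\<le>r. of_rat (DN * poly.coeff p i) * (((u - z) / (of_nat d * g)) ^ i * (u / g) ^ (r - i)))"
    by (simp add: DN_def sum_distrib_left of_rat_mult of_rat_divide mult.assoc)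
  moreover have "algebraic_int (of_rat (DN * poly.coeff p i) :: complex)" for i
  proof -
    have "DN * poly.coeff p i \<in> \<int>" unfolding DN_def p_def by (rule D_div_N_int_poly[OF n d])
    then obtain m where "DN * poly.coeff p i = of_int m" by (auto elim: Ints_cases)
    thus ?thesis by simp
  qed
  ultimately show ?thesis
    using ints by (auto intro!: algebraic_int_sum algebraic_int_mult algebraic_int_power)
qed

section \<open>The irrationality measure\<close>

text \<open>For the least \<open>r\<close> with \<open>2 * cmod q * l < E ^ r\<close>, the \<open>r\<close>-th or the next approximant differs from
  \<open>p / q\<close>. The factor 3/2 costs \<open>3/4\<close> of the lower bound 1 for a nonzero element of \<open>R\<close>; the
  remaining 1/4 accounts for the 4 in the conclusion.\<close>

lemma approximation_lower_bound:
  fixes A p q :: complex and P Q :: "nat \<Rightarrow> complex" and k l E F \<kappa> :: real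
  assumes R: "\<And>a b c e. a \<in> R \<Longrightarrow> b \<in> R \<Longrightarrow> c \<in> R \<Longrightarrow> e \<in> R \<Longrightarrow> a * b - c * e \<in> R"
      "0 \<in> R" "\<And>z. z \<in> R \<Longrightarrow> z \<noteq> 0 \<Longrightarrow> cmod z \<ge> 1"
    and PQ: "\<And>r. P r \<in> R" "\<And>r. Q r \<in> R" "\<And>r. P r * Q (Suc r) \<noteq> P (Suc r) * Q r"
    and Q_less: "\<And>r. cmod (Q r) < k * F ^ r"
    and rem: "\<And>r. cmod (Q r * A - P r) \<le> 3 / 2 * (l / E ^ r)"
    and E: "E > 1" and F: "F > 0" and l: "l \<ge> 0" and \<kappa>: "\<kappa> = ln F / ln E"
    and pq: "p \<in> R" "q \<in> R" "q \<noteq> 0"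
  shows "cmod (A - p / q) > 1 / (4 * k * F * max 1 (2 * l * E) powr \<kappa> * cmod q powr (\<kappa> + 1))"
proof -
  have k: "k > 0" using le_less_trans[OF norm_ge_zero Q_less[of 0]] by simp
  have Q_ge_1: "1 \<le> cmod (Q r)" if "Q r \<noteq> 0" for r using R(3)[OF PQ(2) that] .
  have q1: "cmod q \<ge> 1" by (rule R(3)[OF pq(2,3)])
  \<comment> \<open>For \<open>F < 1\<close> the bound on \<open>Q\<close> drops below 1, so two
    consecutive denominators would be 0, against their independence. This makes
    \<open>\<kappa>\<close> non-negative.\<close>
  have F1: "F \<ge> 1"
  proof (rule ccontr)
    assume "\<not> F \<ge> 1"
    hence "F < 1" by simp
    then obtain r where r: "F ^ r < 1 / k" using real_arch_pow_inv[of "1 / k" F] k by auto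
    hence *: "k * F ^ r < 1" using k by (simp add: field_simps)
    have "Q r = 0" using Q_less[of r] Q_ge_1[of r] * by fastforce
    moreover have "k * F ^ Suc r \<le> k * F ^ r" using k F \<open>F < 1\<close> by (simp add: mult_left_le_one_le)
    hence "Q (Suc r) = 0" using Q_less[of "Suc r"] Q_ge_1[of "Suc r"] * by fastforce
    ultimately show False using PQ(3)[of r] by simp
  qed
  have \<kappa>0: "\<kappa> \<ge> 0" using \<kappa> F1 E by simp
  have EF: "E powr \<kappa> = F" using E F by (simp add: \<kappa> powr_def)
  define M where "M = max 1 (2 * l * E)"
  define r0 where "r0 = (LEAST r. 2 * cmod q * l < E ^ r)"
  have ex: "\<exists>r. 2 * cmod q * l < E ^ r" using real_arch_pow[OF E] by blast
  have r0: "2 * cmod q * l < E ^ r0" unfolding r0_def by (rule LeastI_ex[OF ex])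
  have Mq: "1 \<le> M * cmod q" using q1 mult_mono[of 1 M 1 "cmod q"] by (simp add: M_def)
  \<comment> \<open>Since \<open>F\<close> is \<open>E powr \<kappa>\<close>, it suffices to bound
    \<open>E ^ r0\<close>. Minimality of \<open>r0\<close> does so at the cost of one factor
    \<open>E\<close>; for \<open>r0 = 0\<close> there is no predecessor and the 1 inside
    \<open>M\<close> takes over.\<close>
  have F_le: "F ^ r0 \<le> (M * cmod q) powr \<kappa>"
  proof (cases r0)
    case 0
    thus ?thesis using ge_one_powr_ge_zero[OF Mq \<kappa>0] by simp
  next
    case (Suc m)
    have "\<not> 2 * cmod q * l < E ^ m" using not_less_Least[of m "\<lambda>r. 2 * cmod q * l < E ^ r"] Suc
      unfolding r0_def by simp
    hence "E ^ r0 \<le> 2 * cmod q * l * E" using E Suc by (simp add: mult.commute)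
    also have "\<dots> = (2 * l * E) * cmod q" by simp
    also have "\<dots> \<le> M * cmod q" by (intro mult_right_mono) (auto simp: M_def)
    finally have le: "E ^ r0 \<le> M * cmod q" .
    have "F ^ r0 = (E ^ r0) powr \<kappa>"
      using E unfolding EF[symmetric] by (simp add: powr_powr mult.commute flip: powr_realpow)
    also have "\<dots> \<le> (M * cmod q) powr \<kappa>"
      using le E \<kappa>0 by (intro powr_mono2) auto
    finally show ?thesis .
  qed
  obtain r where r: "r = r0 \<or> r = Suc r0" "P r * q \<noteq> Q r * p"
  proof (cases "P r0 * q = Q r0 * p \<and> P (Suc r0) * q = Q (Suc r0) * p")
    case True
    have "(P r0 * Q (Suc r0)) * q = (P r0 * q) * Q (Suc r0)" by (simp only: mult_ac)
    also have "\<dots> = (P (Suc r0) * q) * Q r0" using True by (simp only: mult_ac)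
    finally have "P r0 * Q (Suc r0) = P (Suc r0) * Q r0" using pq(3) by (simp add: mult_ac)
    thus ?thesis using PQ(3)[of r0] by simp
  qed (use that in blast)
  have Er: "2 * cmod q * l < E ^ r"
  proof -
    have "E ^ r0 \<le> E ^ r" using r(1) E by (intro power_increasing) auto
    thus ?thesis using r0 by linarith
  qed
  \<comment> \<open>The extra \<open>F\<close> pays for the case \<open>r = Suc r0\<close>; it is
    the separate factor \<open>Q\<close> in \<open>c\<close>.\<close>
  have Fr: "F ^ r \<le> F * (M * cmod q) powr \<kappa>"
  proof -
    have "F ^ r \<le> F * F ^ r0" using r(1) F1 by (auto intro: mult_left_le_one_le simp: mult_le_cancel_right1)
    thus ?thesis using F_le F by (meson mult_left_mono order_trans less_imp_le)
  qed
  define \<delta> where "\<delta> = cmod (A - p / q)"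
  have "1 \<le> cmod (P r * q - Q r * p)" using r(2) by (intro R(3) R(1) PQ pq) simp
  also have "P r * q - Q r * p = Q r * q * (A - p / q) - q * (Q r * A - P r)"
    using pq(3) by (simp add: field_simps)
  also have "cmod \<dots> \<le> cmod (Q r) * cmod q * \<delta> + cmod q * cmod (Q r * A - P r)"
    unfolding \<delta>_def norm_mult[symmetric] by (rule norm_triangle_ineq4)
  also have "cmod q * cmod (Q r * A - P r) \<le> cmod q * (3 / 2 * (l / E ^ r))"
    by (intro mult_left_mono rem) auto
  also have "cmod q * (3 / 2 * (l / E ^ r)) < 3 / 4"
    using Er E by (simp add: field_simps)
  finally have 14: "1 / 4 < cmod (Q r) * cmod q * \<delta>" by simp
  have "\<delta> > 0" using 14 by (cases "\<delta> = 0") (auto simp: \<delta>_def)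
  have "cmod (Q r) * cmod q * \<delta> \<le> (k * (F * (M * cmod q) powr \<kappa>)) * cmod q * \<delta>"
    using Q_less[of r] Fr k \<open>\<delta> > 0\<close>
    by (intro mult_right_mono order_trans[OF less_imp_le[OF Q_less] mult_left_mono]) auto
  also have "\<dots> = (k * F * M powr \<kappa> * cmod q powr (\<kappa> + 1)) * \<delta>"
    using q1 by (simp add: powr_mult powr_add M_def)
  finally have "1 / 4 < (k * F * M powr \<kappa> * cmod q powr (\<kappa> + 1)) * \<delta>" using 14 by linarith
  moreover have "k * F * M powr \<kappa> * cmod q powr (\<kappa> + 1) > 0"
    using k F pq(3) by (auto simp: M_def)
  ultimately have "1 / (4 * (k * F * M powr \<kappa> * cmod q powr (\<kappa> + 1))) < \<delta>"
    by (subst pos_divide_less_eq) (auto simp: mult_ac)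
  thus ?thesis by (simp add: \<delta>_def M_def mult_ac)
qed

section \<open>Specialisation to the data of the theorem\<close>

lemma principal_root_eq_powr:
  assumes "n > 0" "W \<noteq> 0"
  shows "principal_root n W = W powr of_real (1 / real n)"
proof -
  have "Ln W = of_real (ln (cmod W)) + \<i> * of_real (Arg W)"
    using assms by (simp add: complex_eq_iff Arg_eq_Im_Ln)
  hence "W powr of_real (1 / real n) = exp (of_real (ln (cmod W) / real n) + \<i> * of_real (Arg W / real n))"
    using assms by (simp add: powr_def field_simps)
  also have "\<dots> = of_real (exp (ln (cmod W) / real n)) * cis (Arg W / real n)"
  proof -
    have "exp (of_real a + \<i> * of_real b) = of_real (exp a) * cis b" for a b :: real
      by (simp add: exp_add cis_conv_exp exp_of_real)
    thus ?thesis .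
  qed
  also have "exp (ln (cmod W) / real n) = root n (cmod W)"
    using assms by (simp add: root_powr_inverse powr_def)
  finally show ?thesis by (simp add: principal_root_def rcis_def)
qed

lemma imaginary_quadratic_fieldD: "imaginary_quadratic_field K \<Longrightarrow> complex_subfield K"
  by (simp add: imaginary_quadratic_field_def complex_subfield_def)

text \<open>Merges the two cases of the hypotheses. For \<open>\<beta>\<^sub>1\<close> in
  \<open>K\<close> the root of \<open>\<tau>\<close> is 1; otherwise dimensions 0 and 1 are
  impossible and the parity of \<open>r\<close> selects \<open>t\<close>. As
  \<open>cmod (csqrt \<tau>)\<close> is at least 1, it bounds \<open>t\<close> in every
  case.\<close>

lemma approximants_in_field:
  fixes r :: nat
  assumes K: "imaginary_quadratic_field K"
    and \<beta>\<^sub>1: "algebraic_int \<beta>\<^sub>1" "\<exists>m\<le>2. ring.dimension CC m K (adjoin K \<beta>\<^sub>1)"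
    and \<tau>_trivial: "adjoin K \<beta>\<^sub>1 = K \<Longrightarrow> \<tau> = 1"
    and \<tau>_quadratic: "adjoin K \<beta>\<^sub>1 \<noteq> K \<Longrightarrow>
          \<tau> \<in> K \<and> algebraic_int \<tau> \<and> adjoin K \<beta>\<^sub>1 = adjoin K (csqrt \<tau>)"
    and params_trivial: "\<beta>\<^sub>1 \<in> K \<Longrightarrow>
          \<beta>\<^sub>2 \<in> K \<and> \<gamma>\<^sub>1 \<in> K \<and> \<gamma>\<^sub>2 \<in> K \<and> \<gamma>\<^sub>1 \<noteq> 0 \<and> \<gamma>\<^sub>2 \<noteq> 0 \<and>
          \<beta>\<^sub>2 \<noteq> \<beta>\<^sub>1 \<and> algebraic_int \<beta>\<^sub>2"
    and params_quadratic: "ring.dimension CC 2 K (adjoin K \<beta>\<^sub>1) \<Longrightarrow>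
          is_the_conjugate K \<beta>\<^sub>1 \<beta>\<^sub>2 \<and> \<gamma>\<^sub>1 \<in> adjoin K \<beta>\<^sub>1 \<and> is_the_conjugate K \<gamma>\<^sub>1 \<gamma>\<^sub>2"
    and x: "x \<in> K"
    and U: "U = - \<gamma>\<^sub>2 * (x - \<beta>\<^sub>2) ^ n"
    and Z: "Z = \<gamma>\<^sub>1 * (x - \<beta>\<^sub>1) ^ n"
    and coeff: "\<And>r k. k \<le> r \<Longrightarrow> of_real (pade_coeff \<sigma> r k) \<in> K"
  shows "\<beta>\<^sub>1 \<noteq> \<beta>\<^sub>2" "algebraic_int \<beta>\<^sub>2" "algebraic_int (csqrt \<tau>)" "cmod (csqrt \<tau>) \<ge> 1"
    "\<exists>t\<in>{1, csqrt \<tau>}.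
       t * approx_num \<beta>\<^sub>1 \<beta>\<^sub>2 x (pade_form \<sigma> r Z U) (pade_form \<sigma> r U Z) \<in> K \<and>
       t * approx_den \<beta>\<^sub>1 \<beta>\<^sub>2 x (pade_form \<sigma> r Z U) (pade_form \<sigma> r U Z) \<in> K"
proof -
  interpret complex_subfield K by (rule imaginary_quadratic_fieldD[OF K])
  define s where "s = csqrt \<tau>"
  have "\<beta>\<^sub>1 \<noteq> \<beta>\<^sub>2 \<and> algebraic_int \<beta>\<^sub>2 \<and> algebraic_int s \<and> cmod s \<ge> 1 \<and>
    (\<exists>t\<in>{1, s}.
       t * approx_num \<beta>\<^sub>1 \<beta>\<^sub>2 x (pade_form \<sigma> r Z U) (pade_form \<sigma> r U Z) \<in> K \<and>
       t * approx_den \<beta>\<^sub>1 \<beta>\<^sub>2 x (pade_form \<sigma> r Z U) (pade_form \<sigma> r U Z) \<in> K)"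
  proof (cases "\<beta>\<^sub>1 \<in> K")
    case True
    note par = params_trivial[OF True]
    have "s = 1" using \<tau>_trivial True adjoin_eq_iff by (simp add: s_def)
    have \<beta>\<^sub>2: "\<beta>\<^sub>2 \<in> K" and \<gamma>: "\<gamma>\<^sub>1 \<in> K" "\<gamma>\<^sub>2 \<in> K" using par by blast+
    have UZ: "U \<in> K" "Z \<in> K"
      unfolding U Z by (intro mult_mem minus_mem power_mem diff_mem x True \<beta>\<^sub>2 \<gamma>)+
    note pf = pade_form_mem[OF coeff UZ] pade_form_mem[OF coeff UZ(2,1)]
    have "approx_num \<beta>\<^sub>1 \<beta>\<^sub>2 x (pade_form \<sigma> r Z U) (pade_form \<sigma> r U Z) \<in> K"
      unfolding approx_num_def by (intro mult_mem diff_mem x True \<beta>\<^sub>2 pf)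
    moreover have "approx_den \<beta>\<^sub>1 \<beta>\<^sub>2 x (pade_form \<sigma> r Z U) (pade_form \<sigma> r U Z) \<in> K"
      unfolding approx_den_def by (intro mult_mem diff_mem x True \<beta>\<^sub>2 pf)
    ultimately show ?thesis using par \<open>s = 1\<close> by auto
  next
    case False
    define L where "L = adjoin K \<beta>\<^sub>1"
    have L: "1 \<in> L" "\<beta>\<^sub>1 \<in> L" "L \<noteq> K"
      using subset_adjoin[of \<beta>\<^sub>1] adjoin_mem[of \<beta>\<^sub>1] adjoin_eq_iff[of \<beta>\<^sub>1] False by (auto simp: L_def)
    obtain m where m: "m \<le> 2" "ring.dimension CC m K L" using \<beta>\<^sub>1(2) by (auto simp: L_def)
    have "m \<noteq> 0"
    proof
      assume "m = 0"
      hence "ring.dimension CC 0 K L" using m(2) by (simp only:)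
      thus False using ring.dimension_zero[OF ring_CC subfield] L(1) by fastforce
    qed
    moreover have "m \<noteq> 1"
    proof
      assume "m = 1"
      hence "ring.dimension CC 1 K L" using m(2) by (simp only:)
      thus False using one_dim_eq[OF _ L(1)] L(3) by blast
    qed
    ultimately have "m = 2" using m(1) by linarith
    hence dim: "ring.dimension CC 2 K L" using m(2) by simp
    note par = params_quadratic[OF dim[unfolded L_def]]
    have \<tau>: "\<tau> \<in> K" "algebraic_int \<tau>" "L = adjoin K s"
      using \<tau>_quadratic L(3) by (auto simp: L_def s_def)
    have sK: "s \<notin> K" "s\<^sup>2 = \<tau>" "s \<in> L"
      using \<tau>(3) L(3) adjoin_eq_iff[of s] adjoin_mem[of s] by (auto simp: s_def)
    interpret quadratic_extension K s
      by unfold_locales (use sK \<tau> in auto)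
    have L_eq: "L = {u + v * s | u v. u \<in> K \<and> v \<in> K}" by (rule two_dim_eq[OF dim L(1) sK(3,1)])
    have conj: "conj_pair y y'" if y: "y \<in> L" "is_the_conjugate K y y'" for y y'
    proof -
      from y(1) obtain u v where "y = u + v * s" "u \<in> K" "v \<in> K" unfolding L_eq by blast
      thus ?thesis by (rule conj_pairI[OF _ _ _ y(2)])
    qed
    have \<beta>: "conj_pair \<beta>\<^sub>1 \<beta>\<^sub>2" and \<gamma>: "conj_pair \<gamma>\<^sub>1 \<gamma>\<^sub>2"
      using conj L(2) par by (simp_all add: L_def)
    have "conj_pair (\<gamma>\<^sub>1 * (x - \<beta>\<^sub>1) ^ n) (\<gamma>\<^sub>2 * (x - \<beta>\<^sub>2) ^ n)"
      by (intro conj_pair_mult conj_pair_power conj_pair_diff \<beta> \<gamma> conj_pair_const x)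
    hence ZU: "conj_pair Z (- U)" by (simp add: U Z)
    have "\<beta>\<^sub>1 \<noteq> \<beta>\<^sub>2" using \<beta> False conj_pair_self_mem by blast
    moreover have "algebraic_int \<beta>\<^sub>2" by (rule conj_pair_algebraic_int[OF \<beta> \<beta>\<^sub>1(1)])
    moreover have "algebraic_int s" using \<tau>(2) by (auto simp: s_def)
    moreover have "cmod s \<ge> 1"
    proof -
      have "\<tau> \<noteq> 0" using sK(1) by (auto simp: s_def)
      hence "1 \<le> cmod \<tau>" by (rule imaginary_quadratic_field_norm_ge_1[OF K \<tau>(1,2)])
      hence "1\<^sup>2 \<le> (cmod s)\<^sup>2" by (simp add: sK(2)[symmetric] norm_power)
      thus ?thesis by (rule power2_le_imp_le) simp
    qed
    moreover have "(if even r then s else 1) \<in> {1, s}" by simp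
    ultimately show ?thesis using approximants_mem[OF \<beta> x ZU coeff, of r] by blast
  qed
  thus "\<beta>\<^sub>1 \<noteq> \<beta>\<^sub>2" "algebraic_int \<beta>\<^sub>2" "algebraic_int (csqrt \<tau>)" "cmod (csqrt \<tau>) \<ge> 1"
    "\<exists>t\<in>{1, csqrt \<tau>}.
       t * approx_num \<beta>\<^sub>1 \<beta>\<^sub>2 x (pade_form \<sigma> r Z U) (pade_form \<sigma> r U Z) \<in> K \<and>
       t * approx_den \<beta>\<^sub>1 \<beta>\<^sub>2 x (pade_form \<sigma> r Z U) (pade_form \<sigma> r U Z) \<in> K"
    unfolding s_def by blast+
qed

text \<open>Numerator and denominator are linear in \<open>(a, b)\<close>, so the determinant is
  multiplied by that of the coefficient matrix; a nonzero factor carries independence over.\<close>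

lemma approx_det:
  "approx_num \<beta>\<^sub>1 \<beta>\<^sub>2 x a b * approx_den \<beta>\<^sub>1 \<beta>\<^sub>2 x a' b' - approx_num \<beta>\<^sub>1 \<beta>\<^sub>2 x a' b' * approx_den \<beta>\<^sub>1 \<beta>\<^sub>2 x a b =
     (\<beta>\<^sub>2 - \<beta>\<^sub>1) * (x - \<beta>\<^sub>1) * (x - \<beta>\<^sub>2) * (a * b' - a' * b)"
  unfolding approx_num_def approx_den_def by (simp add: algebra_simps)

text \<open>The definition of \<open>A\<close> amounts to \<open>(x - \<beta>\<^sub>1) * (A -
  \<beta>\<^sub>2) = (x - \<beta>\<^sub>2) * (A - \<beta>\<^sub>1) * w\<close>, which merges the
  coefficients of \<open>a\<close> and \<open>b\<close>.\<close>

lemma approx_error: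
  assumes "A = (\<beta>\<^sub>1 * (x - \<beta>\<^sub>2) * w - \<beta>\<^sub>2 * (x - \<beta>\<^sub>1)) / ((x - \<beta>\<^sub>2) * w - (x - \<beta>\<^sub>1))"
    and "(x - \<beta>\<^sub>2) * w - (x - \<beta>\<^sub>1) \<noteq> 0"
  shows "approx_den \<beta>\<^sub>1 \<beta>\<^sub>2 x a b * A - approx_num \<beta>\<^sub>1 \<beta>\<^sub>2 x a b = (x - \<beta>\<^sub>2) * (A - \<beta>\<^sub>1) * (a - b * w)"
proof -
  have eq: "A * ((x - \<beta>\<^sub>2) * w - (x - \<beta>\<^sub>1)) = \<beta>\<^sub>1 * (x - \<beta>\<^sub>2) * w - \<beta>\<^sub>2 * (x - \<beta>\<^sub>1)"
    using assms by simp
  have "(x - \<beta>\<^sub>2) * (A - \<beta>\<^sub>1) * w - (x - \<beta>\<^sub>1) * (A - \<beta>\<^sub>2) =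
      A * ((x - \<beta>\<^sub>2) * w - (x - \<beta>\<^sub>1)) - (\<beta>\<^sub>1 * (x - \<beta>\<^sub>2) * w - \<beta>\<^sub>2 * (x - \<beta>\<^sub>1))"
    by (simp add: algebra_simps)
  hence key: "(x - \<beta>\<^sub>1) * (A - \<beta>\<^sub>2) = (x - \<beta>\<^sub>2) * (A - \<beta>\<^sub>1) * w" unfolding eq by simp
  have "approx_den \<beta>\<^sub>1 \<beta>\<^sub>2 x a b * A - approx_num \<beta>\<^sub>1 \<beta>\<^sub>2 x a b =
      (x - \<beta>\<^sub>2) * (A - \<beta>\<^sub>1) * a - (x - \<beta>\<^sub>1) * (A - \<beta>\<^sub>2) * b"
    unfolding approx_num_def approx_den_def by (simp add: algebra_simps)
  also have "\<dots> = (x - \<beta>\<^sub>2) * (A - \<beta>\<^sub>1) * (a - b * w)"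
    unfolding key by (simp add: right_diff_distrib mult_ac)
  finally show ?thesis .
qed

lemma pos_not_nonpos_Int: "(y::real) > 0 \<Longrightarrow> y \<notin> \<int>\<^sub>\<le>\<^sub>0"
  by (auto elim!: nonpos_Ints_cases)

text \<open>The first quotient bounds the size of the approximants, the second is the normalisation
  of the remainder; the Pochhammer form is the one produced by those estimates.\<close>

lemma gamma_factors:
  assumes "n \<ge> 2"
  shows "Gamma (1 - 1 / real n) * fact r / Gamma (real r + 1 - 1 / real n) =
           fact r / pochhammer (1 - 1 / real n) r"
    and "real n * Gamma (real r + 1 + 1 / real n) / (Gamma (1 / real n) * fact r) =
           pochhammer (1 / real n) (Suc r) / (1 / real n * fact r)"
proof -
  have pos: "1 - 1 / real n > 0" "1 / real n > 0" using assms by (auto simp: field_simps)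
  have "pochhammer (1 - 1 / real n) r = Gamma (1 - 1 / real n + real r) / Gamma (1 - 1 / real n)"
    by (intro pochhammer_Gamma pos_not_nonpos_Int pos)
  moreover have "1 - 1 / real n + real r = real r + 1 - 1 / real n" by simp
  ultimately show "Gamma (1 - 1 / real n) * fact r / Gamma (real r + 1 - 1 / real n) =
           fact r / pochhammer (1 - 1 / real n) r" by simp
  have "pochhammer (1 / real n) (Suc r) = Gamma (1 / real n + real (Suc r)) / Gamma (1 / real n)"
    by (intro pochhammer_Gamma pos_not_nonpos_Int pos)
  moreover have "1 / real n + real (Suc r) = real r + 1 + 1 / real n" by simp
  ultimately have "pochhammer (1 / real n) (Suc r) = Gamma (real r + 1 + 1 / real n) / Gamma (1 / real n)"
    by (simp only:)
  thus "real n * Gamma (real r + 1 + 1 / real n) / (Gamma (1 / real n) * fact r) =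
           pochhammer (1 / real n) (Suc r) / (1 / real n * fact r)" by simp
qed

lemma N_cal_pos: "N_cal d n > 0"
  unfolding N_cal_def by (intro prod_pos) (auto simp: in_prime_factors_iff prime_gt_0_nat)


theorem theorem2p4:
  fixes K :: "complex set"
    and \<beta>\<^sub>1 \<beta>\<^sub>2 \<gamma>\<^sub>1 \<gamma>\<^sub>2 \<tau> x g U Z W W_root A :: complex
    and n d :: nat
    and h_seq :: "nat \<Rightarrow> complex"
    and h Cn Dn E Q \<kappa> c :: real
  assumes K: "imaginary_quadratic_field K"
    and \<beta>\<^sub>1: "algebraic_int \<beta>\<^sub>1" "\<exists>m\<le>2. ring.dimension CC m K (adjoin K \<beta>\<^sub>1)"
    and \<tau>_trivial: "adjoin K \<beta>\<^sub>1 = K \<Longrightarrow> \<tau> = 1"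
    and \<tau>_quadratic: "adjoin K \<beta>\<^sub>1 \<noteq> K \<Longrightarrow>
          \<tau> \<in> K \<and> algebraic_int \<tau> \<and> adjoin K \<beta>\<^sub>1 = adjoin K (csqrt \<tau>)"
    and params_trivial: "\<beta>\<^sub>1 \<in> K \<Longrightarrow>
          \<beta>\<^sub>2 \<in> K \<and> \<gamma>\<^sub>1 \<in> K \<and> \<gamma>\<^sub>2 \<in> K \<and> \<gamma>\<^sub>1 \<noteq> 0 \<and> \<gamma>\<^sub>2 \<noteq> 0 \<and>
          \<beta>\<^sub>2 \<noteq> \<beta>\<^sub>1 \<and> algebraic_int \<beta>\<^sub>2"
    and params_quadratic: "ring.dimension CC 2 K (adjoin K \<beta>\<^sub>1) \<Longrightarrow>
          is_the_conjugate K \<beta>\<^sub>1 \<beta>\<^sub>2 \<and> \<gamma>\<^sub>1 \<in> adjoin K \<beta>\<^sub>1 \<and> is_the_conjugate K \<gamma>\<^sub>1 \<gamma>\<^sub>2"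
    and x: "x \<in> K" "algebraic_int x"
    and n: "n \<ge> 3"
    and U: "U = - \<gamma>\<^sub>2 * (x - \<beta>\<^sub>2) ^ n"
    and Z: "Z = \<gamma>\<^sub>1 * (x - \<beta>\<^sub>1) ^ n"
    and W: "W = Z / U"
    and W_root: "W_root = principal_root n W"
    and A: "A = (\<beta>\<^sub>1 * (x - \<beta>\<^sub>2) * W_root - \<beta>\<^sub>2 * (x - \<beta>\<^sub>1)) /
                ((x - \<beta>\<^sub>2) * W_root - (x - \<beta>\<^sub>1))"
    and nonzero: "g \<noteq> 0" "U \<noteq> 0" "Z \<noteq> 0" "U \<noteq> Z" "(x - \<beta>\<^sub>2) * W_root - (x - \<beta>\<^sub>1) \<noteq> 0"
    and g: "Polynomial.algebraic g" "algebraic_int (U / g)" "algebraic_int (Z / g)"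
    and h: "h > 0"
    and h_seq: "\<And>r. h_seq r \<noteq> 0 \<and> algebraic_int (h_seq r) \<and> h_seq r / g ^ r \<in> K \<and>
                     cmod (h_seq r) \<le> h"
    and d: "d > 0" "algebraic_int ((U - Z) / (of_nat d * g))"
    and d_max: "\<And>d'. d' > 0 \<Longrightarrow> algebraic_int ((U - Z) / (of_nat d' * g)) \<Longrightarrow> d' \<le> d"
    and Cn_Dn: "Cn > 0" "Dn > 0"
    and bound: "\<And>r::nat.
          max 1 (max (Gamma (1 - 1 / real n) * fact r / Gamma (real r + 1 - 1 / real n))
                     (real n * Gamma (real r + 1 + 1 / real n) / (Gamma (1 / real n) * fact r)))
            * (real (D_denom n r) / real_of_int (N_num d n r))
          < Cn * (Dn / N_cal d n) ^ r"
    and E: "E = cmod g * N_cal d n / Dn * (4 * (cmod U - cmod (Z - U)) / (cmod (Z - U))\<^sup>2)"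
    and Q: "Q = Dn / (cmod g * N_cal d n) * (2 * (cmod U + cmod Z))"
    and \<kappa>: "\<kappa> = ln Q / ln E"
    and c: "c = 4 * h * cmod (csqrt \<tau>) * (cmod (x - \<beta>\<^sub>1) + cmod (x - \<beta>\<^sub>2)) * Cn * Q *
                (max 1 (2 * h * cmod (csqrt \<tau>) * cmod (1 - W_root) * cmod (x - \<beta>\<^sub>2) *
                        cmod (A - \<beta>\<^sub>1) * Cn * E)) powr \<kappa>"
    and E_gt_1: "E > 1"
    and W_near_1: "max (cmod (1 - W)) (cmod (1 - 1 / W)) < 1"
  shows "\<forall>p q. p \<in> K \<and> algebraic_int p \<and> q \<in> K \<and> algebraic_int q \<and> q \<noteq> 0 \<longrightarrow>
           cmod (A - p / q) > 1 / (c * cmod q powr (\<kappa> + 1))"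
proof (intro allI impI, elim conjE)
  fix p q assume pq: "p \<in> K" "algebraic_int p" "q \<in> K" "algebraic_int q" "q \<noteq> 0"
  interpret complex_subfield K by (rule imaginary_quadratic_fieldD[OF K])
  define s where "s = csqrt \<tau>"
  define \<sigma> where "\<sigma> = 1 / real n"
  have n2: "n \<ge> 2" using n by simp
  have \<sigma>: "0 < \<sigma>" "\<sigma> < 1" using n by (auto simp: \<sigma>_def)
  have coeff: "of_real (pade_coeff \<sigma> r k) \<in> K" if "k \<le> r" for r k
    using pade_coeff_mem_Rats[OF n2 that] Rats_subset unfolding \<sigma>_def by blast
  note fld = approximants_in_field[OF K \<beta>\<^sub>1 \<tau>_trivial \<tau>_quadratic params_trivial params_quadratic
      x(1) U Z coeff, folded s_def]
  define a where "a = (\<lambda>r. pade_form \<sigma> r Z U)"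
  define b where "b = (\<lambda>r. pade_form \<sigma> r U Z)"
  define num where "num = (\<lambda>r. approx_num \<beta>\<^sub>1 \<beta>\<^sub>2 x (a r) (b r))"
  define den where "den = (\<lambda>r. approx_den \<beta>\<^sub>1 \<beta>\<^sub>2 x (a r) (b r))"
  have "\<forall>r. \<exists>t\<in>{1, s}. t * num r \<in> K \<and> t * den r \<in> K"
    unfolding num_def den_def a_def b_def using fld(5) by blast
  then obtain t where t: "t r \<in> {1, s}" "t r * num r \<in> K" "t r * den r \<in> K" for r by metis
  have t_int: "algebraic_int (t r)" and t_norm: "cmod (t r) \<le> cmod s" and t_nz: "t r \<noteq> 0" for r
    using t(1)[of r] fld(3,4) by auto
  define D where "D = (\<lambda>r. real (D_denom n r) / real_of_int (N_num d n r))"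
  \<comment> \<open>Membership in \<open>K\<close> needs \<open>h_seq r / g ^ r\<close> kept
    together; integrality regroups it, with \<open>h_seq r\<close> apart and \<open>g ^ r\<close>
    below the forms.\<close>
  define e where "e = (\<lambda>r. t r * (h_seq r / g ^ r) * of_real (D r))"
  define P where "P = (\<lambda>r. e r * num r)"
  define Q' where "Q' = (\<lambda>r. e r * den r)"
  have D_pos: "D r > 0" for r using D_denom(1) N_num_pos[OF n2 d(1)] by (simp add: D_def)
  have e_nz: "e r \<noteq> 0" for r
    using t_nz h_seq[of r] nonzero(1) D_pos[of r] by (simp add: e_def)
  have e_mem: "e r * y \<in> K" if "t r * y \<in> K" for r y
  proof -
    have "of_real (D r) = (of_nat (D_denom n r) / of_int (N_num d n r) :: complex)" by (simp add: D_def)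
    hence "of_real (D r) \<in> K" by (metis divide_mem of_nat_mem of_int_mem)
    hence "(h_seq r / g ^ r) * of_real (D r) * (t r * y) \<in> K" using h_seq[of r] that by blast
    thus ?thesis by (simp add: e_def mult_ac)
  qed
  have ZU_int: "algebraic_int ((U - Z) / (of_nat d * g))" "algebraic_int ((Z - U) / (of_nat d * g))"
    using d(2) algebraic_int_minus[OF d(2)] by (simp_all add: minus_divide_left)
  \<comment> \<open>The second form arises by exchanging \<open>U\<close> and \<open>Z\<close>,
    which only changes the sign of \<open>U - Z\<close>, so the same \<open>d\<close> and
    \<open>D r\<close> serve both.\<close>
  have form_int: "algebraic_int (of_real (D r) * (a r / g ^ r))" "algebraic_int (of_real (D r) * (b r / g ^ r))" for r
    using algebraic_int_pade_form[OF n2 d(1) nonzero(2,1) g(2) ZU_int(1), of r]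
      algebraic_int_pade_form[OF n2 d(1) nonzero(3,1) g(3) ZU_int(2), of r]
    by (simp_all add: D_def a_def b_def \<sigma>_def)
  define R where "R = {z \<in> K. algebraic_int z}"
  have P_R: "P r \<in> R" for r
  proof -
    have "P r = t r * h_seq r * (\<beta>\<^sub>1 * (x - \<beta>\<^sub>2) * (of_real (D r) * (a r / g ^ r)) -
        \<beta>\<^sub>2 * (x - \<beta>\<^sub>1) * (of_real (D r) * (b r / g ^ r)))"
      by (simp add: P_def e_def num_def approx_num_def right_diff_distrib mult_ac)
    moreover have "algebraic_int \<dots>"
      using h_seq[of r]
      by (intro algebraic_int_mult algebraic_int_diff form_int t_int \<beta>\<^sub>1 x fld) auto
    ultimately have "algebraic_int (P r)" by (simp only:)
    thus ?thesis using e_mem[OF t(2)] by (simp add: R_def P_def)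
  qed
  have Q_R: "Q' r \<in> R" for r
  proof -
    have "Q' r = t r * h_seq r * ((x - \<beta>\<^sub>2) * (of_real (D r) * (a r / g ^ r)) -
        (x - \<beta>\<^sub>1) * (of_real (D r) * (b r / g ^ r)))"
    proof -
      have "v1 * (v2 / v3) * v4 * (v5 * v6 - v7 * v8) =
          v1 * v2 * (v5 * (v4 * (v6 / v3)) - v7 * (v4 * (v8 / v3)))"
        for v1 v2 v3 v4 v5 v6 v7 v8 :: complex
        by (simp add: right_diff_distrib diff_divide_distrib mult_ac)
      thus ?thesis unfolding Q'_def e_def den_def approx_den_def .
    qed
    moreover have "algebraic_int \<dots>"
      using h_seq[of r]
      by (intro algebraic_int_mult algebraic_int_diff form_int t_int \<beta>\<^sub>1 x fld) auto
    ultimately have "algebraic_int (Q' r)" by (simp only:)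
    thus ?thesis using e_mem[OF t(3)] by (simp add: R_def Q'_def)
  qed
  have x\<beta>: "x - \<beta>\<^sub>1 \<noteq> 0" "x - \<beta>\<^sub>2 \<noteq> 0" using nonzero(2,3) n by (auto simp: U Z)
  have W0: "W \<noteq> 0" "W \<noteq> 1" using nonzero by (auto simp: W)
  have aX: "a r = U ^ r * pade_X \<sigma> r W" and bY: "b r = U ^ r * pade_Y \<sigma> r W" for r
    using nonzero(2) by (simp_all add: a_def b_def W pade_form_conv_X pade_form_conv_Y)
  have det: "P r * Q' (Suc r) \<noteq> P (Suc r) * Q' r" for r
  proof
    assume eq: "P r * Q' (Suc r) = P (Suc r) * Q' r"
    have "e r * e (Suc r) * (num r * den (Suc r) - num (Suc r) * den r) =
        P r * Q' (Suc r) - P (Suc r) * Q' r"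
      by (simp add: P_def Q'_def right_diff_distrib mult_ac)
    hence "num r * den (Suc r) - num (Suc r) * den r = 0" using eq e_nz by simp
    hence "(\<beta>\<^sub>2 - \<beta>\<^sub>1) * (x - \<beta>\<^sub>1) * (x - \<beta>\<^sub>2) * (a r * b (Suc r) - a (Suc r) * b r) = 0"
      unfolding num_def den_def approx_det .
    hence "a r * b (Suc r) - a (Suc r) * b r = 0" using fld(1) x\<beta> by simp
    moreover have "a r * b (Suc r) - a (Suc r) * b r = U ^ r * U ^ Suc r *
        (pade_X \<sigma> r W * pade_Y \<sigma> (Suc r) W - pade_X \<sigma> (Suc r) W * pade_Y \<sigma> r W)"
      unfolding aX bY by (simp add: right_diff_distrib mult_ac)
    ultimately show False using pade_det_neq_0[OF \<sigma> W0(2), of r] nonzero(2) by simp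
  qed
  have root: "W_root = W powr of_real \<sigma>"
    unfolding W_root \<sigma>_def using principal_root_eq_powr n W0 by simp
  have err: "Q' r * A - P r = e r * ((x - \<beta>\<^sub>2) * (A - \<beta>\<^sub>1) * (a r - b r * W_root))" for r
    unfolding approx_error[OF A nonzero(5), of "a r" "b r", symmetric] P_def Q'_def num_def den_def
    by (simp add: right_diff_distrib mult_ac)
  have W1: "cmod (W - 1) < 1" "Re W > 1 / 2"
  proof -
    show "cmod (W - 1) < 1" using W_near_1 by (simp add: norm_minus_commute)
    \<comment> \<open>The condition on \<open>1 / W\<close> says that \<open>W\<close> is closer to
      1 than to 0.\<close>
    have "cmod (1 - 1 / W) = cmod (W - 1) / cmod W"
      using W0 by (simp add: field_simps flip: norm_divide)
    hence "cmod (W - 1) < cmod W" using W_near_1 W0 by simp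
    hence "(cmod (W - 1))\<^sup>2 < (cmod W)\<^sup>2" by (intro power_strict_mono) auto
    thus "Re W > 1 / 2" by (simp add: cmod_power2) (simp add: power2_eq_square algebra_simps)
  qed
  define B where "B = (cmod (W - 1))\<^sup>2 / (4 * (1 - cmod (W - 1)))"
  \<comment> \<open>The factor \<open>U ^ r\<close> of the homogenisation clears \<open>W\<close>;
    the result is the reciprocal of the quotient in \<open>E\<close>.\<close>
  have B: "cmod U * B = (cmod (Z - U))\<^sup>2 / (4 * (cmod U - cmod (Z - U)))"
  proof -
    have *: "cmod (W - 1) = cmod (Z - U) / cmod U"
      using nonzero(2) by (simp add: W field_simps flip: norm_divide)
    have "cmod U > 0" "cmod (Z - U) < cmod U" using nonzero(2) W1(1) * by (auto simp: field_simps)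
    thus ?thesis unfolding B_def * by (simp add: field_simps power2_eq_square)
  qed
  define F where "F = Dn / N_cal d n"
  have F: "F > 0" using Cn_Dn N_cal_pos by (simp add: F_def)
  \<comment> \<open>\<open>k\<close> and \<open>l\<close> collect what does not depend on
    \<open>r\<close> in the bounds for the denominators and for the errors, so that
    \<open>4 * k * Q\<close> and \<open>2 * l * E\<close> are the expressions in
    \<open>c\<close>.\<close>
  define k where "k = h * cmod s * (cmod (x - \<beta>\<^sub>1) + cmod (x - \<beta>\<^sub>2)) * Cn"
  define l where "l = h * cmod s * cmod (1 - W_root) * cmod (x - \<beta>\<^sub>2) * cmod (A - \<beta>\<^sub>1) * Cn"
  have e_le: "cmod (e r) \<le> h * cmod s * D r / cmod g ^ r" for r
  proof -
    have "cmod (e r) = cmod (t r) * cmod (h_seq r) * (D r / cmod g ^ r)"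
      using D_pos[of r] by (simp add: e_def norm_mult norm_divide norm_power)
    also have "\<dots> \<le> cmod s * h * (D r / cmod g ^ r)"
      using D_pos[of r] h_seq[of r] t_norm[of r] by (intro mult_right_mono mult_mono) auto
    finally show ?thesis by (simp add: mult_ac)
  qed
  have bnd: "max 1 (max (fact r / pochhammer (1 - \<sigma>) r) (pochhammer \<sigma> (Suc r) / (\<sigma> * fact r))) * D r
      < Cn * F ^ r" for r
    using bound[of r, unfolded gamma_factors[OF n2]] by (simp only: \<sigma>_def D_def F_def)
  have bnd1: "fact r / pochhammer (1 - \<sigma>) r * D r < Cn * F ^ r" for r
    using less_imp_le[OF D_pos] by (intro le_less_trans[OF mult_right_mono bnd]) auto
  have bnd2: "pochhammer \<sigma> (Suc r) / (\<sigma> * fact r) * D r < Cn * F ^ r" for r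
    using less_imp_le[OF D_pos] by (intro le_less_trans[OF mult_right_mono bnd]) auto
  have Q_less: "cmod (Q' r) < k * Q ^ r" for r
  proof -
    define T where "T = (2 * (cmod U + cmod Z)) ^ r"
    have T: "T > 0" using nonzero by (auto simp: T_def add_pos_pos)
    have "cmod (den r) \<le> cmod (x - \<beta>\<^sub>2) * cmod (a r) + cmod (x - \<beta>\<^sub>1) * cmod (b r)"
      unfolding den_def approx_den_def norm_mult[symmetric] by (rule norm_triangle_ineq4)
    also have "\<dots> \<le> cmod (x - \<beta>\<^sub>2) * (fact r / pochhammer (1 - \<sigma>) r * T) +
        cmod (x - \<beta>\<^sub>1) * (fact r / pochhammer (1 - \<sigma>) r * T)"
      using norm_pade_form_le[OF \<sigma>, of r Z U] norm_pade_form_le[OF \<sigma>, of r U Z]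
      by (intro add_mono mult_left_mono) (auto simp: a_def b_def T_def add.commute)
    finally have den_le: "cmod (den r) \<le>
        (cmod (x - \<beta>\<^sub>1) + cmod (x - \<beta>\<^sub>2)) * (fact r / pochhammer (1 - \<sigma>) r) * T"
      by (simp add: algebra_simps)
    have "cmod (Q' r) \<le> (h * cmod s * D r / cmod g ^ r) *
        ((cmod (x - \<beta>\<^sub>1) + cmod (x - \<beta>\<^sub>2)) * (fact r / pochhammer (1 - \<sigma>) r) * T)"
      unfolding Q'_def norm_mult using e_le[of r] den_le h D_pos[of r]
      by (intro mult_mono) auto
    also have "\<dots> = h * cmod s * (cmod (x - \<beta>\<^sub>1) + cmod (x - \<beta>\<^sub>2)) * (T / cmod g ^ r) *
        (fact r / pochhammer (1 - \<sigma>) r * D r)" by simp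
    \<comment> \<open>Every factor in front is positive, so the strictness of the hypothesis on
      \<open>Cn\<close> survives.\<close>
    also have "\<dots> < h * cmod s * (cmod (x - \<beta>\<^sub>1) + cmod (x - \<beta>\<^sub>2)) * (T / cmod g ^ r) * (Cn * F ^ r)"
      using h fld(4) x\<beta> T nonzero(1)
      by (intro mult_strict_left_mono bnd1 mult_pos_pos divide_pos_pos add_pos_pos) auto
    also have "\<dots> = k * Q ^ r"
      by (simp add: k_def T_def Q F_def power_mult_distrib power_divide mult_ac)
    finally show ?thesis .
  qed
  have rem: "cmod (Q' r * A - P r) \<le> 3 / 2 * (l / E ^ r)" for r
  proof -
    define C where "C = pochhammer \<sigma> (Suc r) / (\<sigma> * fact r)"
    have "cmod (a r - b r * W_root) = cmod U ^ r * cmod (W powr of_real \<sigma> * pade_Y \<sigma> r W - pade_X \<sigma> r W)"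
    proof -
      have "a r - b r * W_root = - (U ^ r * (W powr of_real \<sigma> * pade_Y \<sigma> r W - pade_X \<sigma> r W))"
        by (simp add: aX bY root right_diff_distrib mult_ac)
      thus ?thesis by (simp only: norm_minus_cancel norm_mult norm_power)
    qed
    also have "\<dots> \<le> cmod U ^ r * (3 / 2 * C * cmod (W powr of_real \<sigma> - 1) * B ^ r)"
      unfolding C_def B_def by (intro mult_left_mono pade_remainder_bound \<sigma> W1) auto
    also have "\<dots> = 3 / 2 * C * cmod (1 - W_root) * (cmod U * B) ^ r"
      by (simp add: root norm_minus_commute power_mult_distrib mult_ac)
    finally have ab: "cmod (a r - b r * W_root) \<le> 3 / 2 * C * cmod (1 - W_root) * (cmod U * B) ^ r" .
    have UB: "cmod U * B \<ge> 0" using W1 by (simp add: B_def)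
    have "cmod (Q' r * A - P r) \<le> (h * cmod s * D r / cmod g ^ r) *
      (cmod (x - \<beta>\<^sub>2) * cmod (A - \<beta>\<^sub>1) * (3 / 2 * C * cmod (1 - W_root) * (cmod U * B) ^ r))"
      unfolding err norm_mult using e_le[of r] ab h D_pos[of r]
      by (intro mult_mono mult_left_mono) auto
    also have "\<dots> = 3 / 2 * (h * cmod s * cmod (1 - W_root) * cmod (x - \<beta>\<^sub>2) * cmod (A - \<beta>\<^sub>1) *
        ((cmod U * B) ^ r / cmod g ^ r) * (C * D r))" by (simp add: mult_ac)
    also have "\<dots> \<le> 3 / 2 * (h * cmod s * cmod (1 - W_root) * cmod (x - \<beta>\<^sub>2) * cmod (A - \<beta>\<^sub>1) *
        ((cmod U * B) ^ r / cmod g ^ r) * (Cn * F ^ r))"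
      using h UB bnd2[of r]
      by (intro mult_left_mono mult_nonneg_nonneg divide_nonneg_nonneg) (auto simp: C_def)
    also have "\<dots> = 3 / 2 * (l * (cmod U * B * F / cmod g) ^ r)"
      by (simp add: l_def power_mult_distrib power_divide mult_ac)
    also have "cmod U * B * F / cmod g = 1 / E"
      unfolding B E F_def by (simp add: mult_ac)
    finally show ?thesis by (simp add: power_divide)
  qed
  have "cmod (A - p / q) > 1 / (4 * k * Q * max 1 (2 * l * E) powr \<kappa> * cmod q powr (\<kappa> + 1))"
  proof (rule approximation_lower_bound[where R = R and P = P and Q = Q', OF _ _ _ P_R Q_R det Q_less rem E_gt_1 _ _ \<kappa>])
    show "y * z - v * w \<in> R" if "y \<in> R" "z \<in> R" "v \<in> R" "w \<in> R" for y z v w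
      using that by (auto simp: R_def)
    show "0 \<in> R" by (simp add: R_def)
    show "1 \<le> cmod z" if "z \<in> R" "z \<noteq> 0" for z
      using imaginary_quadratic_field_norm_ge_1[OF K] that by (simp add: R_def)
    show "Q > 0" using F nonzero unfolding Q F_def by (intro mult_pos_pos divide_pos_pos add_pos_pos) (auto simp: Cn_Dn N_cal_pos)
    show "l \<ge> 0" using h Cn_Dn by (simp add: l_def)
  qed (use pq in \<open>auto simp: R_def\<close>)
  also have "4 * k * Q * max 1 (2 * l * E) powr \<kappa> = c"
    unfolding c k_def l_def s_def by (simp add: mult_ac)
  finally show "1 / (c * cmod q powr (\<kappa> + 1)) < cmod (A - p / q)" .
qed

end
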